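(* Let $(M^n,g)$ be a compact Riemannian spin manifold with nonempty smooth boundary and let $(N,h)$ be a Riemannian manifold. Assume the existence of a parallel involutive, real- or complex-linear, symmetric or Hermitian, endomorphism field $\mathcal{G}$ of $\Sigma M$ which anti-commutes with the Clifford multiplication by tangent vectors on $M$. Split $\Sigma M=\Sigma_+M\oplus\Sigma_-M$, where $\Sigma_\pm M:=\ker(\mathcal{G}\mp\mathrm{id})\subset\Sigma M$. Let $f_0\colon M\to N$ be any harmonic map satisfying the Dirichlet or Neumann boundary condition. Let $B\subset\check H(A_0)$ be any elliptic boundary condition for $D^{f_0}$ satisfying $\partial_t\phi(0)\in B$ for every variation $(\phi_t)_t$ of some $\phi_0$ satisfying $\phi_t|_{\partial M}\in B$ for all $t$. Assume also that $\mathcal{G}\otimes\mathrm{id}|_{\partial M}$, seen as a pointwise endomorphism field of $\Sigma M\otimes f_0^*TN$ along $\partial M$, preserves $B$, i.e. $(\mathcal{G}\otimes\mathrm{id})(B)\subset B$. Then for any $\phi_0\in\ker(D^{f_0})$ with $\phi_0|_{\partial M}\in B$, writing $\phi_0=\phi_{0+}+\phi_{0-}$ with $\phi_{0\pm}\in\Gamma(\Sigma_\pm M\otimes f_0^*TN)$, both $(f_0,\phi_{0+})$ and $(f_0,\phi_{0-})$ are uncoupled Dirac-harmonic maps.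
   Context: Let $\Sigma M$ be the complex spinor bundle of $M$ with its Hermitian metric, spin connection and Clifford multiplication "$\cdot$" (with $X\cdot X\cdot=-|X|^2$); $\nu$ is the inner unit normal along $\partial M$. For a smooth map $f\colon M\to N$, the bundle $\Sigma M\otimes f^*TN$ (real tensor product) carries the tensor product connection $\nabla$ of the spin connection and the pull-back Levi-Civita connection, and $D^f\phi:=\sum_{j=1}^n(e_j\cdot\otimes\mathrm{id})\nabla_{e_j}\phi$ for a local orthonormal basis $(e_j)$ of $TM$. For $\phi\in\Gamma(\Sigma M\otimes f^*TN)$ the section $V_\phi\in\Gamma(f^*TN)$ is defined by $h(V_\phi,Y)=\sum_{j=1}^n\langle(e_j\cdot\otimes R^N_{df(e_j),Y})\phi,\phi\rangle$ for all tangent vectors $Y$ to $N$, where $R^N$ is the curvature tensor of $N$. A map $f$ is harmonic if $\mathrm{tr}_g(\nabla df)=0$. Dirichlet boundary condition: $f|_{\partial M}=u$ for a fixed smooth $u\colon\partial M\to N$. Neumann boundary condition: $df(\nu)=0$ on $\partial M$. A pair $(f_0,\phi_0)$ is a Dirac-harmonic map (with prescribed boundary conditions; here: the given Dirichlet or Neumann condition for the map and $B$ for the spinor) if $D^{f_0}\phi_0=0$ and $\mathrm{tr}_g(\nabla df_0)=\frac12V_{\phi_0}$ on $M$ and $f_0,\phi_0$ satisfy the prescribed boundary conditions; it is uncoupled if $V_{\phi_0}=0$. Boundary conditions for spinors. Let $E=f^*TN$ and $\Sigma:=\Sigma M|_{\partial M}$, identified with $\Sigma\partial M$ if $n$ is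 odd and with $\Sigma\partial M\oplus\Sigma\partial M$ if $n$ is even, with the connection induced by the intrinsic spin connection of $\partial M$. Set $A_0:=\sum_{j=1}^{n-1}(e_j\cdot\nu\cdot\otimes\mathrm{id})\nabla^{\Sigma\otimes E}_{e_j}$ on $\Gamma(\partial M,\Sigma\otimes E)$, which is elliptic and self-adjoint with discrete real spectrum. A boundary condition for $D^f$ is a closed subspace $B$ of $\check H(A_0):=H^{1/2}_{(-\infty,a)}(A_0)\oplus H^{-1/2}_{[a,\infty)}(A_0)$ ($a\in\mathbb{R}$ arbitrary), where $H^{s}_{I}(A_0)$ is the $H^s$-closure of $\bigoplus_{\lambda\in I}\ker(A_0-\lambda)$. Its adjoint is $B^{\rm ad}:=\{\varphi\in\check H(A_0)\mid(\nu\cdot\varphi,\psi)=0\ \forall\psi\in B\}$ with respect to the natural pairing. Ellipticity is in the sense of Bär–Ballmann: both $B$ and $B^{\rm ad}$ are contained in $H^{1/2}(\partial M,\Sigma\otimes E)$. Variations. A variation $(\phi_t)_{t\in(-\varepsilon,\varepsilon)}$ of $\phi_0$ is a smooth family with $\phi_t\in\Gamma(\Sigma M\otimes f_t^*TN)$, where $(f_t)$ is a smooth variation of $f_0$ satisfying the same Dirichlet or Neumann boundary condition; $\partial_t\phi(0)$ denotes the natural covariant derivative of $(t,x)\mapsto\phi(t,x)$ along $\partial_t$ at $t=0$ (and "$\partial_t\phi(0)\in B$" refers to its restriction to $\partial M$). If the boundary values of $f_t$ vary with $t$, "$\phi_t|_{\partial M}\in B$" refers to the corresponding boundary condition for $D^{f_t}$,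 denoted by the same letter. *)

theory Defs
  imports "HOL-Analysis.Analysis"
begin

section \<open>Smooth functions and one-sided partial derivatives\<close>

primrec C_k :: "nat \<Rightarrow> 'a::euclidean_space set \<Rightarrow> ('a \<Rightarrow> 'b::real_normed_vector) \<Rightarrow> bool" where
  "C_k 0 U f \<longleftrightarrow> continuous_on U f"
| "C_k (Suc r) U f \<longleftrightarrow> (\<forall>x\<in>U. f differentiable (at x)) \<and>
     (\<forall>v\<in>Basis. C_k r U (\<lambda>x. frechet_derivative f (at x) v))"

text \<open>Smoothness on an arbitrary set means local extendability to a smooth function on an open set;
  this is the usual convention for half-spaces and hyperplanes.\<close>

definition smooth_on :: "'a::euclidean_space set \<Rightarrow> ('a \<Rightarrow> 'b::real_normed_vector) \<Rightarrow> bool" where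
  "smooth_on A f \<longleftrightarrow>
     (\<forall>x\<in>A. \<exists>U g. open U \<and> x \<in> U \<and> (\<forall>r. C_k r U g) \<and> (\<forall>y\<in>A \<inter> U. g y = f y))"

definition half_space :: "'n::finite \<Rightarrow> (real^'n) set" where
  "half_space k = {x. 0 \<le> x $ k}"

text \<open>Directional derivative inside the model space \<open>H\<close>. For \<open>H = half_space k\<close> and a point of the
  boundary hyperplane, the derivative in the direction of the \<open>k\<close>-th axis is the one-sided one.\<close>

definition dir_deriv ::
  "'a::real_normed_vector set \<Rightarrow> 'a \<Rightarrow> ('a \<Rightarrow> 'b::real_normed_vector) \<Rightarrow> 'a \<Rightarrow> 'b" where
  "dir_deriv H v F x = vector_derivative (\<lambda>t. F (x + t *\<^sub>R v)) (at 0 within {t. x + t *\<^sub>R v \<in> H})"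


section \<open>Riemannian manifolds\<close>

text \<open>The underlying space of a manifold is a Hausdorff, second countable type \<open>'p\<close>. A smooth
  structure is given by an indexed atlas, modelled on \<open>H = half_space k\<close> (manifolds with boundary)
  or on \<open>H = UNIV\<close> (no boundary); tensors are given by their components in the charts.
  Several indices may carry the same chart.\<close>

record ('p, 'i, 'n::finite) riem =
  patch :: "'i \<Rightarrow> 'p set"
  coord :: "'i \<Rightarrow> 'p \<Rightarrow> real^'n"
  gmat :: "'i \<Rightarrow> 'p \<Rightarrow> real^'n^'n"

definition coord_inv :: "('p, 'i, 'n::finite, 'z) riem_scheme \<Rightarrow> 'i \<Rightarrow> real^'n \<Rightarrow> 'p" where
  "coord_inv M i = inv_into (patch M i) (coord M i)"

definition smooth_in_chart ::
  "('p, 'i, 'n::finite, 'z) riem_scheme \<Rightarrow> 'i \<Rightarrow> 'p set \<Rightarrow> ('p \<Rightarrow> 'b::real_normed_vector) \<Rightarrow> bool" where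
  "smooth_in_chart M i W F \<longleftrightarrow> smooth_on (coord M i ` (W \<inter> patch M i)) (F \<circ> coord_inv M i)"

definition pd ::
  "(real^'n) set \<Rightarrow> ('p, 'i, 'n::finite, 'z) riem_scheme \<Rightarrow> 'i \<Rightarrow> ('p \<Rightarrow> 'b::real_normed_vector)
    \<Rightarrow> 'p \<Rightarrow> 'n \<Rightarrow> 'b" where
  "pd H M i F p a = dir_deriv H (axis a 1) (F \<circ> coord_inv M i) (coord M i p)"

text \<open>Components in chart \<open>i'\<close> of a tangent vector with components \<open>v\<close> in chart \<open>i\<close>:
  \<open>jac H M i' i p *v v\<close>.\<close>

definition jac ::
  "(real^'n) set \<Rightarrow> ('p, 'i, 'n::finite, 'z) riem_scheme \<Rightarrow> 'i \<Rightarrow> 'i \<Rightarrow> 'p \<Rightarrow> real^'n^'n" where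
  "jac H M i' i p = (\<chi> b c. pd H M i (coord M i') p c $ b)"

definition gip ::
  "('p, 'i, 'n::finite, 'z) riem_scheme \<Rightarrow> 'i \<Rightarrow> 'p \<Rightarrow> real^'n \<Rightarrow> real^'n \<Rightarrow> real" where
  "gip M i p u v = u \<bullet> (gmat M i p *v v)"

definition riemannian_manifold ::
  "(real^'n) set
    \<Rightarrow> ('p::{t2_space,second_countable_topology}, 'i, 'n::finite, 'z) riem_scheme \<Rightarrow> bool" where
  "riemannian_manifold H M \<longleftrightarrow>
     (\<Union>i. patch M i) = UNIV \<and>
     (\<forall>i. open (patch M i) \<and>
          openin (top_of_set H) (coord M i ` patch M i) \<and>
          homeomorphism (patch M i) (coord M i ` patch M i) (coord M i) (coord_inv M i)) \<and>
     (\<forall>i j. smooth_in_chart M i (patch M j) (coord M j)) \<and>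
     (\<forall>i. smooth_in_chart M i UNIV (gmat M i)) \<and>
     (\<forall>i. \<forall>p\<in>patch M i.
          (\<forall>u v. gip M i p u v = gip M i p v u) \<and> (\<forall>u. u \<noteq> 0 \<longrightarrow> gip M i p u u > 0)) \<and>
     (\<forall>i j. \<forall>p\<in>patch M i \<inter> patch M j. \<forall>u v.
          gip M i p u v = gip M j p (jac H M j i p *v u) (jac H M j i p *v v))"

text \<open>\<open>christoffel H M i p a b c\<close> is \<open>\<Gamma>\<^sup>c\<^sub>a\<^sub>b\<close>, i.e.
  \<open>\<nabla>\<^sub>a \<partial>\<^sub>b = \<Sum>\<^sub>c \<Gamma>\<^sup>c\<^sub>a\<^sub>b \<partial>\<^sub>c\<close> for the Levi-Civita connection.\<close>

definition christoffel ::
  "(real^'n) set \<Rightarrow> ('p, 'i, 'n::finite, 'z) riem_scheme \<Rightarrow> 'i \<Rightarrow> 'p \<Rightarrow> 'n \<Rightarrow> 'n \<Rightarrow> 'n \<Rightarrow> real" where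
  "christoffel H M i p a b c =
     (1/2) * (\<Sum>d\<in>UNIV. matrix_inv (gmat M i p) $ c $ d *
        (pd H M i (\<lambda>q. gmat M i q $ b $ d) p a + pd H M i (\<lambda>q. gmat M i q $ a $ d) p b
         - pd H M i (\<lambda>q. gmat M i q $ a $ b) p d))"

text \<open>Covariant derivative of a vector field with chart components \<open>Y\<close> in the direction of the
  \<open>a\<close>-th coordinate vector field.\<close>

definition lc_nabla ::
  "(real^'n) set \<Rightarrow> ('p, 'i, 'n::finite, 'z) riem_scheme \<Rightarrow> 'i \<Rightarrow> ('p \<Rightarrow> real^'n) \<Rightarrow> 'p \<Rightarrow> 'n
    \<Rightarrow> real^'n" where
  "lc_nabla H M i Y p a =
     pd H M i Y p a + (\<chi> c. \<Sum>d\<in>UNIV. christoffel H M i p a d c * Y p $ d)"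

text \<open>Matrix of \<open>R(X,Y) = [\<nabla>\<^sub>X, \<nabla>\<^sub>Y] - \<nabla>\<^sub>[\<^sub>X\<^sub>,\<^sub>Y\<^sub>]\<close>.\<close>

definition curvature ::
  "(real^'n) set \<Rightarrow> ('p, 'i, 'n::finite, 'z) riem_scheme \<Rightarrow> 'i \<Rightarrow> 'p \<Rightarrow> real^'n \<Rightarrow> real^'n
    \<Rightarrow> real^'n^'n" where
  "curvature H M i p X Y = (\<chi> a b. \<Sum>c\<in>UNIV. \<Sum>d\<in>UNIV. X $ c * Y $ d *
     (pd H M i (\<lambda>q. christoffel H M i q d b a) p c - pd H M i (\<lambda>q. christoffel H M i q c b a) p d
      + (\<Sum>e\<in>UNIV. christoffel H M i p c e a * christoffel H M i p d b e
                  - christoffel H M i p d e a * christoffel H M i p c b e)))"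


section \<open>Maps between manifolds\<close>

definition smooth_map ::
  "('p::topological_space, 'i, 'n::finite, 'y) riem_scheme
    \<Rightarrow> ('q::topological_space, 'j, 'm::finite, 'z) riem_scheme \<Rightarrow> 'p set \<Rightarrow> ('p \<Rightarrow> 'q) \<Rightarrow> bool" where
  "smooth_map M N W f \<longleftrightarrow> continuous_on W f \<and>
     (\<forall>i j. smooth_in_chart M i (W \<inter> f -` patch N j) (coord N j \<circ> f))"

definition bdry :: "'n::finite \<Rightarrow> ('p, 'i, 'n, 'z) riem_scheme \<Rightarrow> 'p set" where
  "bdry k M = {p. \<exists>i. p \<in> patch M i \<and> coord M i p $ k = 0}"

text \<open>The inner unit normal, in the components of chart \<open>i\<close>.\<close>

definition normal ::
  "'n::finite \<Rightarrow> ('p, 'i, 'n, 'z) riem_scheme \<Rightarrow> 'i \<Rightarrow> 'p \<Rightarrow> real^'n" where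
  "normal k M i p = (THE v. gip M i p v v = 1 \<and> v $ k > 0 \<and> (\<forall>w. w $ k = 0 \<longrightarrow> gip M i p v w = 0))"

text \<open>\<open>df(\<partial>\<^sub>a)\<close>, from chart \<open>i\<close> to chart \<open>j\<close>.\<close>

definition dmap ::
  "'n::finite \<Rightarrow> ('p, 'i, 'n, 'y) riem_scheme \<Rightarrow> ('q, 'j, 'm::finite, 'z) riem_scheme
    \<Rightarrow> ('p \<Rightarrow> 'q) \<Rightarrow> 'i \<Rightarrow> 'j \<Rightarrow> 'p \<Rightarrow> 'n \<Rightarrow> real^'m" where
  "dmap k M N f i j p a = pd (half_space k) M i (coord N j \<circ> f) p a"

text \<open>The tension field \<open>tr\<^sub>g(\<nabla>df)\<close>.\<close>

definition tension ::
  "'n::finite \<Rightarrow> ('p, 'i, 'n, 'y) riem_scheme \<Rightarrow> ('q, 'j, 'm::finite, 'z) riem_scheme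
    \<Rightarrow> ('p \<Rightarrow> 'q) \<Rightarrow> 'i \<Rightarrow> 'j \<Rightarrow> 'p \<Rightarrow> real^'m" where
  "tension k M N f i j p =
     (\<Sum>a\<in>UNIV. \<Sum>b\<in>UNIV. matrix_inv (gmat M i p) $ a $ b *\<^sub>R
        (pd (half_space k) M i (\<lambda>q. dmap k M N f i j q b) p a
         - (\<Sum>d\<in>UNIV. christoffel (half_space k) M i p a b d *\<^sub>R dmap k M N f i j p d)
         + (\<chi> c. \<Sum>d\<in>UNIV. \<Sum>e\<in>UNIV. christoffel UNIV N j (f p) d e c *
              dmap k M N f i j p a $ d * dmap k M N f i j p b $ e)))"

datatype ('p, 'q) map_bc = Dirichlet "'p \<Rightarrow> 'q" | Neumann

text \<open>The values of a Dirichlet datum away from the boundary are irrelevant.\<close>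

fun satisfies_bc ::
  "'n::finite \<Rightarrow> ('p, 'i, 'n, 'y) riem_scheme \<Rightarrow> ('q, 'j, 'm::finite, 'z) riem_scheme
    \<Rightarrow> ('p, 'q) map_bc \<Rightarrow> ('p \<Rightarrow> 'q) \<Rightarrow> bool" where
  "satisfies_bc k M N (Dirichlet u) f \<longleftrightarrow> (\<forall>p\<in>bdry k M. f p = u p)"
| "satisfies_bc k M N Neumann f \<longleftrightarrow>
     (\<forall>i j. \<forall>p\<in>bdry k M \<inter> patch M i \<inter> f -` patch N j.
        (\<Sum>a\<in>UNIV. normal k M i p $ a *\<^sub>R dmap k M N f i j p a) = 0)"

fun smooth_bc ::
  "'n::finite \<Rightarrow> ('p::topological_space, 'i, 'n, 'y) riem_scheme
    \<Rightarrow> ('q::topological_space, 'j, 'm::finite, 'z) riem_scheme \<Rightarrow> ('p, 'q) map_bc \<Rightarrow> bool" where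
  "smooth_bc k M N (Dirichlet u) \<longleftrightarrow> smooth_map M N (bdry k M) u"
| "smooth_bc k M N Neumann \<longleftrightarrow> True"

definition harmonic_map ::
  "'n::finite \<Rightarrow> ('p::topological_space, 'i, 'n, 'y) riem_scheme
    \<Rightarrow> ('q::topological_space, 'j, 'm::finite, 'z) riem_scheme \<Rightarrow> ('p \<Rightarrow> 'q) \<Rightarrow> bool" where
  "harmonic_map k M N f \<longleftrightarrow> smooth_map M N UNIV f \<and>
     (\<forall>i j. \<forall>p\<in>patch M i \<inter> f -` patch N j. tension k M N f i j p = 0)"


section \<open>Spin structures and the spinor bundle\<close>

definition cip :: "complex^'s::finite \<Rightarrow> complex^'s \<Rightarrow> complex" where
  "cip x y = (\<Sum>\<sigma>\<in>UNIV. x $ \<sigma> * cnj (y $ \<sigma>))"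

text \<open>A spin structure is presented by a cocycle: over each \<open>patch M i\<close> there is an orthonormal frame
  \<open>(frame M i p a)\<^sub>a\<close> (in the components of chart \<open>i\<close>), and the transition functions of these
  frames are lifted to functions \<open>lift M i j\<close> with values in the spin group. Every spin structure on
  a manifold has such a presentation, since atlases can be refined to contractible patches.
  The spinor bundle has the fibre \<open>complex^'s\<close>, and \<open>\<psi>\<^sub>i = lift M i j \<psi>\<^sub>j\<close> for the local
  representatives of a spinor. The matrices \<open>clif M a\<close> generate the Clifford module.\<close>

record ('p, 'i, 'n::finite, 's::finite) spin = "('p, 'i, 'n) riem" +
  clif :: "'n \<Rightarrow> complex^'s^'s"
  frame :: "'i \<Rightarrow> 'p \<Rightarrow> 'n \<Rightarrow> real^'n"
  lift :: "'i \<Rightarrow> 'i \<Rightarrow> 'p \<Rightarrow> complex^'s^'s"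

definition clif_vec :: "('n::finite \<Rightarrow> complex^'s::finite^'s) \<Rightarrow> real^'n \<Rightarrow> complex^'s^'s" where
  "clif_vec \<gamma> v = (\<Sum>a\<in>UNIV. v $ a *\<^sub>R \<gamma> a)"

text \<open>The image of \<open>Spin(n)\<close> in the automorphisms of the spinor module, on which it acts
  faithfully.\<close>

definition spin_group :: "('n::finite \<Rightarrow> complex^'s::finite^'s) \<Rightarrow> (complex^'s^'s) set" where
  "spin_group \<gamma> = {foldr (\<lambda>v A. clif_vec \<gamma> v ** A) vs (mat 1) | vs.
      even (length vs) \<and> (\<forall>v\<in>set vs. norm v = 1)}"

text \<open>A module over the complexified Clifford algebra of this dimension is irreducible. In odd
  dimensions there are two such modules, and either of them is allowed.\<close>

definition spinor_module :: "('n::finite \<Rightarrow> complex^'s::finite^'s) \<Rightarrow> bool" where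
  "spinor_module \<gamma> \<longleftrightarrow> CARD('s) = 2 ^ (CARD('n) div 2) \<and>
     (\<forall>a b. \<gamma> a ** \<gamma> b + \<gamma> b ** \<gamma> a = (if a = b then -2 *\<^sub>R mat 1 else 0)) \<and>
     (\<forall>a x y. cip (\<gamma> a *v x) y = - cip x (\<gamma> a *v y))"

text \<open>Clifford multiplication by the tangent vector with components \<open>v\<close> in chart \<open>i\<close>.\<close>

definition cmul ::
  "('p, 'i, 'n::finite, 's::finite, 'z) spin_scheme \<Rightarrow> 'i \<Rightarrow> 'p \<Rightarrow> real^'n \<Rightarrow> complex^'s^'s" where
  "cmul M i p v = clif_vec (clif M) (\<chi> a. gip M i p v (frame M i p a))"

text \<open>The last condition but one says that conjugation with \<open>lift M i j p\<close> is the rotation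
  relating the frames of index \<open>i\<close> and \<open>j\<close>.\<close>

definition spin_structure ::
  "'n::finite \<Rightarrow> ('p::topological_space, 'i, 'n, 's::finite, 'z) spin_scheme \<Rightarrow> bool" where
  "spin_structure k M \<longleftrightarrow> spinor_module (clif M) \<and>
     (\<forall>i a. smooth_in_chart M i UNIV (\<lambda>p. frame M i p a)) \<and>
     (\<forall>i. \<forall>p\<in>patch M i. \<forall>a b. gip M i p (frame M i p a) (frame M i p b) = (if a = b then 1 else 0)) \<and>
     (\<forall>i j. smooth_in_chart M i (patch M j) (lift M i j)) \<and>
     (\<forall>i j. \<forall>p\<in>patch M i \<inter> patch M j. lift M i j p \<in> spin_group (clif M)) \<and>
     (\<forall>i j. \<forall>p\<in>patch M i \<inter> patch M j. \<forall>b.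
        lift M i j p ** clif M b =
        cmul M i p (jac (half_space k) M i j p *v frame M j p b) ** lift M i j p) \<and>
     (\<forall>i j l. \<forall>p\<in>patch M i \<inter> patch M j \<inter> patch M l. lift M i j p ** lift M j l p = lift M i l p)"

text \<open>The spin connection in the direction of the \<open>a\<close>-th coordinate vector field, on the local
  representative \<open>\<psi>\<close> of a spinor field over \<open>patch M i\<close>:
  \<open>\<partial>\<^sub>a\<psi> + 1/4 \<Sum>\<^sub>b\<^sub>c g(\<nabla>\<^sub>a e\<^sub>b, e\<^sub>c) e\<^sub>b \<cdot> e\<^sub>c \<cdot> \<psi>\<close>.\<close>

definition spin_nabla ::
  "'n::finite \<Rightarrow> ('p, 'i, 'n, 's::finite, 'z) spin_scheme \<Rightarrow> 'i \<Rightarrow> ('p \<Rightarrow> complex^'s) \<Rightarrow> 'p \<Rightarrow> 'n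
    \<Rightarrow> complex^'s" where
  "spin_nabla k M i \<psi> p a = pd (half_space k) M i \<psi> p a +
     (1/4) *\<^sub>R (\<Sum>b\<in>UNIV. \<Sum>c\<in>UNIV.
        gip M i p (lc_nabla (half_space k) M i (\<lambda>q. frame M i q b) p a) (frame M i p c) *\<^sub>R
        (clif M b *v (clif M c *v \<psi> p)))"

text \<open>An endomorphism field of the spinor bundle, given by its local representatives. The two
  alternatives are ``real-linear and symmetric'' and ``complex-linear and Hermitian''.\<close>

definition real_symmetric :: "(complex^'s::finite \<Rightarrow> complex^'s) \<Rightarrow> bool" where
  "real_symmetric T \<longleftrightarrow> linear T \<and> (\<forall>x y. Re (cip (T x) y) = Re (cip x (T y)))"

definition complex_hermitian :: "(complex^'s::finite \<Rightarrow> complex^'s) \<Rightarrow> bool" where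
  "complex_hermitian T \<longleftrightarrow> (\<forall>x y. T (x + y) = T x + T y) \<and> (\<forall>z x. T (z *s x) = z *s T x) \<and>
     (\<forall>x y. cip (T x) y = cip x (T y))"

definition spinor_endomorphism_field ::
  "('p, 'i, 'n::finite, 's::finite, 'z) spin_scheme \<Rightarrow> ('i \<Rightarrow> 'p \<Rightarrow> complex^'s \<Rightarrow> complex^'s) \<Rightarrow> bool"
where
  "spinor_endomorphism_field M G \<longleftrightarrow>
     ((\<forall>i. \<forall>p\<in>patch M i. real_symmetric (G i p)) \<or>
      (\<forall>i. \<forall>p\<in>patch M i. complex_hermitian (G i p))) \<and>
     (\<forall>i x. smooth_in_chart M i UNIV (\<lambda>p. G i p x)) \<and>
     (\<forall>i j. \<forall>p\<in>patch M i \<inter> patch M j. \<forall>x. G i p (lift M i j p *v x) = lift M i j p *v G j p x)"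

definition parallel_endomorphism ::
  "'n::finite \<Rightarrow> ('p::topological_space, 'i, 'n, 's::finite, 'z) spin_scheme
    \<Rightarrow> ('i \<Rightarrow> 'p \<Rightarrow> complex^'s \<Rightarrow> complex^'s) \<Rightarrow> bool" where
  "parallel_endomorphism k M G \<longleftrightarrow>
     (\<forall>i W \<psi>. open W \<and> W \<subseteq> patch M i \<and> smooth_in_chart M i W \<psi> \<longrightarrow>
        (\<forall>p\<in>W. \<forall>a. spin_nabla k M i (\<lambda>q. G i q (\<psi> q)) p a = G i p (spin_nabla k M i \<psi> p a)))"

definition chirality_field ::
  "'n::finite \<Rightarrow> ('p::topological_space, 'i, 'n, 's::finite, 'z) spin_scheme
    \<Rightarrow> ('i \<Rightarrow> 'p \<Rightarrow> complex^'s \<Rightarrow> complex^'s) \<Rightarrow> bool" where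
  "chirality_field k M G \<longleftrightarrow> spinor_endomorphism_field M G \<and> parallel_endomorphism k M G \<and>
     (\<forall>i. \<forall>p\<in>patch M i. \<forall>x. G i p (G i p x) = x) \<and>
     (\<forall>i. \<forall>p\<in>patch M i. \<forall>v x. G i p (cmul M i p v *v x) = - (cmul M i p v *v G i p x))"


section \<open>Spinors along a map and the twisted Dirac operator\<close>

text \<open>A section of \<open>\<Sigma>M \<otimes> f\<^sup>*TN\<close> is given by its local representatives with respect to an index \<open>i\<close>
  for \<open>M\<close> and a chart \<open>j\<close> of \<open>N\<close>: \<open>\<phi> i j p $ b\<close> is the spinor coefficient of the \<open>b\<close>-th coordinate
  vector field of chart \<open>j\<close>.\<close>

type_synonym ('p, 'i, 'j, 's, 'm) twisted_spinor = "'i \<Rightarrow> 'j \<Rightarrow> 'p \<Rightarrow> ((complex, 's) vec, 'm) vec"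

text \<open>Sections over a subset \<open>W\<close>, without regularity. They are set to zero where they are not
  meaningful, so that equal sections are equal functions.\<close>

definition rough_sections ::
  "'n::finite \<Rightarrow> ('p, 'i, 'n, 's::finite, 'y) spin_scheme \<Rightarrow> ('q, 'j, 'm::finite, 'z) riem_scheme
    \<Rightarrow> ('p \<Rightarrow> 'q) \<Rightarrow> 'p set \<Rightarrow> ('p, 'i, 'j, 's, 'm) twisted_spinor set" where
  "rough_sections k M N f W = {\<phi>.
     (\<forall>i j p. p \<notin> W \<inter> patch M i \<inter> f -` patch N j \<longrightarrow> \<phi> i j p = 0) \<and>
     (\<forall>i i' j j'. \<forall>p \<in> W \<inter> patch M i \<inter> patch M i' \<inter> f -` (patch N j \<inter> patch N j'). \<forall>b.
        \<phi> i' j' p $ b =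
        (\<Sum>c\<in>UNIV. jac UNIV N j' j (f p) $ b $ c *\<^sub>R (lift M i' i p *v \<phi> i j p $ c)))}"

definition smooth_sections ::
  "'n::finite \<Rightarrow> ('p, 'i, 'n, 's::finite, 'y) spin_scheme \<Rightarrow> ('q, 'j, 'm::finite, 'z) riem_scheme
    \<Rightarrow> ('p \<Rightarrow> 'q) \<Rightarrow> 'p set \<Rightarrow> ('p, 'i, 'j, 's, 'm) twisted_spinor set" where
  "smooth_sections k M N f W = {\<phi> \<in> rough_sections k M N f W.
     \<forall>i j. smooth_in_chart M i (W \<inter> f -` patch N j) (\<phi> i j)}"

text \<open>The Hermitian metric of \<open>\<Sigma>M \<otimes> f\<^sup>*TN\<close> at \<open>p\<close>, in a chart \<open>j\<close> around \<open>f p\<close>.\<close>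

definition tw_ip ::
  "('q, 'j, 'm::finite, 'z) riem_scheme \<Rightarrow> 'j \<Rightarrow> 'q \<Rightarrow> complex^'s::finite^'m \<Rightarrow> complex^'s^'m \<Rightarrow> complex"
where
  "tw_ip N j q x y = (\<Sum>b\<in>UNIV. \<Sum>c\<in>UNIV. gmat N j q $ b $ c *\<^sub>R cip (x $ b) (y $ c))"

text \<open>The tensor product of the spin connection and the pull-back Levi-Civita connection.\<close>

definition tw_nabla ::
  "'n::finite \<Rightarrow> ('p, 'i, 'n, 's::finite, 'y) spin_scheme \<Rightarrow> ('q, 'j, 'm::finite, 'z) riem_scheme
    \<Rightarrow> ('p \<Rightarrow> 'q) \<Rightarrow> ('p, 'i, 'j, 's, 'm) twisted_spinor \<Rightarrow> 'i \<Rightarrow> 'j \<Rightarrow> 'p \<Rightarrow> 'n \<Rightarrow> complex^'s^'m" where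
  "tw_nabla k M N f \<phi> i j p a =
     (\<chi> b. spin_nabla k M i (\<lambda>q. \<phi> i j q $ b) p a +
        (\<Sum>c\<in>UNIV. \<Sum>d\<in>UNIV.
           (christoffel UNIV N j (f p) c d b * dmap k M N f i j p a $ c) *\<^sub>R (\<phi> i j p $ d)))"

definition dirac ::
  "'n::finite \<Rightarrow> ('p, 'i, 'n, 's::finite, 'y) spin_scheme \<Rightarrow> ('q, 'j, 'm::finite, 'z) riem_scheme
    \<Rightarrow> ('p \<Rightarrow> 'q) \<Rightarrow> ('p, 'i, 'j, 's, 'm) twisted_spinor \<Rightarrow> 'i \<Rightarrow> 'j \<Rightarrow> 'p \<Rightarrow> complex^'s^'m" where
  "dirac k M N f \<phi> i j p =
     (\<chi> b. \<Sum>l\<in>UNIV. cmul M i p (frame M i p l) *v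
        (\<Sum>a\<in>UNIV. frame M i p l $ a *\<^sub>R (tw_nabla k M N f \<phi> i j p a $ b)))"

definition dirac_kernel ::
  "'n::finite \<Rightarrow> ('p, 'i, 'n, 's::finite, 'y) spin_scheme \<Rightarrow> ('q, 'j, 'm::finite, 'z) riem_scheme
    \<Rightarrow> ('p \<Rightarrow> 'q) \<Rightarrow> ('p, 'i, 'j, 's, 'm) twisted_spinor set" where
  "dirac_kernel k M N f = {\<phi> \<in> smooth_sections k M N f UNIV.
     \<forall>i j. \<forall>p\<in>patch M i \<inter> f -` patch N j. dirac k M N f \<phi> i j p = 0}"

text \<open>The vector field \<open>V\<^sub>\<phi>\<close> along \<open>f\<close>. Clifford multiplication and the curvature endomorphisms are both
  skew, so the Hermitian products in its definition are real numbers; \<open>Re\<close> only adjusts the type.\<close>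

definition V_field ::
  "'n::finite \<Rightarrow> ('p, 'i, 'n, 's::finite, 'y) spin_scheme \<Rightarrow> ('q, 'j, 'm::finite, 'z) riem_scheme
    \<Rightarrow> ('p \<Rightarrow> 'q) \<Rightarrow> ('p, 'i, 'j, 's, 'm) twisted_spinor \<Rightarrow> 'i \<Rightarrow> 'j \<Rightarrow> 'p \<Rightarrow> real^'m" where
  "V_field k M N f \<phi> i j p = (THE v. \<forall>Y. gip N j (f p) v Y =
     (\<Sum>l\<in>UNIV. Re (tw_ip N j (f p)
        (\<chi> b. \<Sum>c\<in>UNIV.
           curvature UNIV N j (f p) (\<Sum>a\<in>UNIV. frame M i p l $ a *\<^sub>R dmap k M N f i j p a) Y $ b $ c *\<^sub>R
           (cmul M i p (frame M i p l) *v \<phi> i j p $ c))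
        (\<phi> i j p))))"

text \<open>The action of \<open>G \<otimes> id\<close> (a tensor product over the reals).\<close>

definition tw_act ::
  "('p, 'i, 'n::finite, 's::finite, 'z) spin_scheme \<Rightarrow> ('i \<Rightarrow> 'p \<Rightarrow> complex^'s \<Rightarrow> complex^'s)
    \<Rightarrow> ('p, 'i, 'j, 's, 'm::finite) twisted_spinor \<Rightarrow> ('p, 'i, 'j, 's, 'm) twisted_spinor" where
  "tw_act M G \<phi> = (\<lambda>i j p. if p \<in> patch M i then (\<chi> b. G i p (\<phi> i j p $ b)) else 0)"

text \<open>\<open>\<phi> = \<phi>p + \<phi>m\<close> with smooth sections of \<open>ker(G - id) \<otimes> f\<^sup>*TN\<close> and \<open>ker(G + id) \<otimes> f\<^sup>*TN\<close>.\<close>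

definition chirality_splitting ::
  "'n::finite \<Rightarrow> ('p, 'i, 'n, 's::finite, 'y) spin_scheme \<Rightarrow> ('q, 'j, 'm::finite, 'z) riem_scheme
    \<Rightarrow> ('p \<Rightarrow> 'q) \<Rightarrow> ('i \<Rightarrow> 'p \<Rightarrow> complex^'s \<Rightarrow> complex^'s)
    \<Rightarrow> ('p, 'i, 'j, 's, 'm) twisted_spinor \<Rightarrow> ('p, 'i, 'j, 's, 'm) twisted_spinor
    \<Rightarrow> ('p, 'i, 'j, 's, 'm) twisted_spinor \<Rightarrow> bool" where
  "chirality_splitting k M N f G \<phi> \<phi>p \<phi>m \<longleftrightarrow>
     \<phi>p \<in> smooth_sections k M N f UNIV \<and> \<phi>m \<in> smooth_sections k M N f UNIV \<and>
     (\<forall>i j p. \<phi> i j p = \<phi>p i j p + \<phi>m i j p) \<and>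
     (\<forall>i j. \<forall>p\<in>patch M i \<inter> f -` patch N j. \<forall>b.
        G i p (\<phi>p i j p $ b) = \<phi>p i j p $ b \<and> G i p (\<phi>m i j p $ b) = - (\<phi>m i j p $ b))"


section \<open>The boundary operator\<close>

text \<open>The connection on \<open>\<Sigma> \<otimes> f\<^sup>*TN\<close> over the boundary induced by the intrinsic spin connection, in the
  direction of a tangent vector \<open>X\<close> of the boundary (\<open>X $ k = 0\<close>). The identification of
  \<open>\<Sigma> = \<Sigma>M|\<partial>M\<close> with (one or two copies of) the spinor bundle of the boundary is made by spin frames
  of \<open>M\<close> containing \<open>\<nu>\<close>. In such a frame, the intrinsic connection has only the terms
  \<open>1/4 g(\<nabla>\<^sub>X e\<^sub>b, e\<^sub>c) e\<^sub>b \<cdot> e\<^sub>c \<cdot>\<close> with \<open>e\<^sub>b, e\<^sub>c\<close> tangent to the boundary; removing the remaining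
  terms of the spin connection of \<open>M\<close> amounts to adding \<open>1/2 (\<nabla>\<^sub>X \<nu>) \<cdot> \<nu> \<cdot>\<close>, as shown by the lemma
  \<open>spinorial_gauss\<close> with \<open>\<omega> b c = g(\<nabla>\<^sub>X e\<^sub>b, e\<^sub>c)\<close>, and this expression is independent of the frame.\<close>

definition bdry_nabla ::
  "'n::finite \<Rightarrow> ('p, 'i, 'n, 's::finite, 'y) spin_scheme \<Rightarrow> ('q, 'j, 'm::finite, 'z) riem_scheme
    \<Rightarrow> ('p \<Rightarrow> 'q) \<Rightarrow> ('p, 'i, 'j, 's, 'm) twisted_spinor \<Rightarrow> 'i \<Rightarrow> 'j \<Rightarrow> 'p \<Rightarrow> real^'n \<Rightarrow> complex^'s^'m"
where
  "bdry_nabla k M N f u i j p X =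
     (\<chi> b. (\<Sum>a\<in>UNIV. X $ a *\<^sub>R (tw_nabla k M N f u i j p a $ b)) +
        (1/2) *\<^sub>R (cmul M i p (\<Sum>a\<in>UNIV. X $ a *\<^sub>R lc_nabla (half_space k) M i (normal k M i) p a) *v
           (cmul M i p (normal k M i p) *v u i j p $ b)))"

lemma spinorial_gauss:
  fixes \<gamma> :: "'n::finite \<Rightarrow> complex^'s::finite^'s" and \<omega> :: "'n \<Rightarrow> 'n \<Rightarrow> real"
  assumes "spinor_module \<gamma>" and skew: "\<And>b c. \<omega> b c = - \<omega> c b"
  shows "(1/4) *\<^sub>R (\<Sum>b\<in>UNIV. \<Sum>c\<in>UNIV. \<omega> b c *\<^sub>R (\<gamma> b ** \<gamma> c)) +
           (1/2) *\<^sub>R (clif_vec \<gamma> (\<chi> c. \<omega> k c) ** \<gamma> k) =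
         (1/4) *\<^sub>R (\<Sum>b\<in>-{k}. \<Sum>c\<in>-{k}. \<omega> b c *\<^sub>R (\<gamma> b ** \<gamma> c))"
proof -
  have anti: "\<gamma> c ** \<gamma> k = - (\<gamma> k ** \<gamma> c)" if "c \<noteq> k" for c
    using assms(1) that by (auto simp: spinor_module_def eq_neg_iff_add_eq_0)
  have kk: "\<omega> k k = 0"
    using skew[of k k] by simp
  have split: "sum h UNIV = h k + sum h (-{k})" for h :: "'n \<Rightarrow> complex^'s^'s"
    using sum.remove[of UNIV k h] by (simp add: Compl_eq_Diff_UNIV)
  define P where "P = (\<Sum>c\<in>-{k}. \<omega> k c *\<^sub>R (\<gamma> k ** \<gamma> c))"
  define Q where "Q = (\<Sum>b\<in>-{k}. \<Sum>c\<in>-{k}. \<omega> b c *\<^sub>R (\<gamma> b ** \<gamma> c))"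
  have col: "(\<Sum>b\<in>-{k}. \<omega> b k *\<^sub>R (\<gamma> b ** \<gamma> k)) = P"
    unfolding P_def
  proof (rule sum.cong)
    fix b assume "b \<in> -{k}"
    then have "\<gamma> b ** \<gamma> k = - (\<gamma> k ** \<gamma> b)" by (simp add: anti)
    moreover have "\<omega> b k = - \<omega> k b" by (rule skew)
    ultimately show "\<omega> b k *\<^sub>R (\<gamma> b ** \<gamma> k) = \<omega> k b *\<^sub>R (\<gamma> k ** \<gamma> b)"
      by (metis scaleR_minus_left scaleR_minus_right minus_minus)
  qed simp
  have full: "(\<Sum>b\<in>UNIV. \<Sum>c\<in>UNIV. \<omega> b c *\<^sub>R (\<gamma> b ** \<gamma> c)) = P + (P + Q)"
  proof -
    have rows: "(\<Sum>c\<in>UNIV. \<omega> b c *\<^sub>R (\<gamma> b ** \<gamma> c)) =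
        \<omega> b k *\<^sub>R (\<gamma> b ** \<gamma> k) + (\<Sum>c\<in>-{k}. \<omega> b c *\<^sub>R (\<gamma> b ** \<gamma> c))" for b
      by (rule split)
    have "(\<Sum>b\<in>UNIV. \<Sum>c\<in>UNIV. \<omega> b c *\<^sub>R (\<gamma> b ** \<gamma> c)) =
        (\<omega> k k *\<^sub>R (\<gamma> k ** \<gamma> k) + P) + (\<Sum>b\<in>-{k}. \<omega> b k *\<^sub>R (\<gamma> b ** \<gamma> k) +
          (\<Sum>c\<in>-{k}. \<omega> b c *\<^sub>R (\<gamma> b ** \<gamma> c)))"
      unfolding rows P_def by (rule split)
    then show ?thesis
      by (simp only: sum.distrib col kk Q_def scaleR_zero_left add_0_left)
  qed
  have "clif_vec \<gamma> (\<chi> c. \<omega> k c) ** \<gamma> k = (\<Sum>c\<in>UNIV. \<omega> k c *\<^sub>R (\<gamma> c ** \<gamma> k))"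
  proof -
    interpret L: linear "\<lambda>A. A ** \<gamma> k"
      by unfold_locales
        (simp_all add: matrix_matrix_mult_def vec_eq_iff sum.distrib distrib_right scaleR_sum_right)
    show ?thesis
      by (simp only: clif_vec_def L.sum L.scale vec_lambda_beta)
  qed
  also have "\<dots> = - P"
  proof -
    have "(\<Sum>c\<in>-{k}. \<omega> k c *\<^sub>R (\<gamma> c ** \<gamma> k)) = (\<Sum>c\<in>-{k}. - (\<omega> k c *\<^sub>R (\<gamma> k ** \<gamma> c)))"
      by (rule sum.cong) (simp_all only: anti Compl_iff singleton_iff not_False_eq_True scaleR_minus_right)
    then show ?thesis
      unfolding P_def by (simp only: split kk scaleR_zero_left add_0_left sum_negf)
  qed
  finally show ?thesis
  proof -
    assume *: "clif_vec \<gamma> (\<chi> c. \<omega> k c) ** \<gamma> k = - P"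
    have "(1/4) *\<^sub>R P + (1/4) *\<^sub>R P = (1/2) *\<^sub>R P"
      by (simp flip: scaleR_add_left)
    then show ?thesis
      unfolding full * by (simp add: Q_def scaleR_add_right flip: add.assoc)
  qed
qed

definition tangential_onb ::
  "'n::finite \<Rightarrow> ('p, 'i, 'n, 'z) riem_scheme \<Rightarrow> 'i \<Rightarrow> 'p \<Rightarrow> ('n \<Rightarrow> real^'n) \<Rightarrow> bool" where
  "tangential_onb k M i p e \<longleftrightarrow> (\<forall>l\<in>-{k}. e l $ k = 0) \<and>
     (\<forall>l\<in>-{k}. \<forall>m\<in>-{k}. gip M i p (e l) (e m) = (if l = m then 1 else 0))"

text \<open>\<open>A\<^sub>0 = \<Sum>\<^sub>l (e\<^sub>l \<cdot> \<nu> \<cdot>) \<nabla>\<^sub>e\<^sub>l\<close>, which does not depend on the chosen orthonormal basis.\<close>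

definition A_0 ::
  "'n::finite \<Rightarrow> ('p, 'i, 'n, 's::finite, 'y) spin_scheme \<Rightarrow> ('q, 'j, 'm::finite, 'z) riem_scheme
    \<Rightarrow> ('p \<Rightarrow> 'q) \<Rightarrow> ('p, 'i, 'j, 's, 'm) twisted_spinor \<Rightarrow> ('p, 'i, 'j, 's, 'm) twisted_spinor" where
  "A_0 k M N f u = (\<lambda>i j p.
     if p \<in> bdry k M \<inter> patch M i \<inter> f -` patch N j
     then let e = (SOME e. tangential_onb k M i p e) in
       (\<chi> b. \<Sum>l\<in>-{k}. cmul M i p (e l) *v (cmul M i p (normal k M i p) *v
          (bdry_nabla k M N f u i j p (e l) $ b)))
     else 0)"

definition A_0_kernel ::
  "'n::finite \<Rightarrow> ('p, 'i, 'n, 's::finite, 'y) spin_scheme \<Rightarrow> ('q, 'j, 'm::finite, 'z) riem_scheme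
    \<Rightarrow> ('p \<Rightarrow> 'q) \<Rightarrow> real \<Rightarrow> ('p, 'i, 'j, 's, 'm) twisted_spinor set" where
  "A_0_kernel k M N f l = {u \<in> smooth_sections k M N f (bdry k M).
     A_0 k M N f u = (\<lambda>i j p. l *\<^sub>R u i j p)}"

definition normal_act ::
  "'n::finite \<Rightarrow> ('p, 'i, 'n, 's::finite, 'y) spin_scheme
    \<Rightarrow> ('p, 'i, 'j, 's, 'm::finite) twisted_spinor \<Rightarrow> ('p, 'i, 'j, 's, 'm) twisted_spinor" where
  "normal_act k M u = (\<lambda>i j p.
     if p \<in> bdry k M \<inter> patch M i then (\<chi> b. cmul M i p (normal k M i p) *v u i j p $ b) else 0)"


section \<open>Integration over the boundary\<close>

definition hyperplane_measure :: "'n::finite \<Rightarrow> (real^'n) measure" where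
  "hyperplane_measure k = distr (\<Pi>\<^sub>M a\<in>-{k}. lborel) borel (\<lambda>x. \<chi> a. if a = k then 0 else x a)"

text \<open>The Riemannian measure of the boundary: in a chart, its density is the square root of the
  determinant of the metric with the \<open>k\<close>-th row and column removed.\<close>

definition bdry_density :: "'n::finite \<Rightarrow> ('p, 'i, 'n, 'z) riem_scheme \<Rightarrow> 'i \<Rightarrow> 'p \<Rightarrow> real" where
  "bdry_density k M i p =
     sqrt (det (\<chi> a b. if a = k \<or> b = k then (if a = b then 1 else 0) else gmat M i p $ a $ b))"

definition bdry_measure ::
  "'n::finite \<Rightarrow> ('p::topological_space, 'i, 'n, 'z) riem_scheme \<Rightarrow> 'p measure \<Rightarrow> bool" where
  "bdry_measure k M \<mu> \<longleftrightarrow> sets \<mu> = sets borel \<and>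
     (\<forall>i. \<forall>A\<in>sets borel. A \<subseteq> patch M i \<longrightarrow>
        emeasure \<mu> A = (\<integral>\<^sup>+ y. ennreal (bdry_density k M i (coord_inv M i y)) *
           indicator (coord M i ` (A \<inter> bdry k M)) y \<partial>hyperplane_measure k))"

text \<open>The pointwise product does not depend on the chosen indices.\<close>

definition pt_ip ::
  "('p, 'i, 'n::finite, 's::finite, 'y) spin_scheme \<Rightarrow> ('q, 'j, 'm::finite, 'z) riem_scheme
    \<Rightarrow> ('p \<Rightarrow> 'q) \<Rightarrow> ('p, 'i, 'j, 's, 'm) twisted_spinor \<Rightarrow> ('p, 'i, 'j, 's, 'm) twisted_spinor
    \<Rightarrow> 'p \<Rightarrow> complex" where
  "pt_ip M N f u v p = (let i = (SOME i. p \<in> patch M i); j = (SOME j. f p \<in> patch N j)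
     in tw_ip N j (f p) (u i j p) (v i j p))"

definition L2_ip ::
  "('p, 'i, 'n::finite, 's::finite, 'y) spin_scheme \<Rightarrow> ('q, 'j, 'm::finite, 'z) riem_scheme
    \<Rightarrow> 'p measure \<Rightarrow> ('p \<Rightarrow> 'q) \<Rightarrow> ('p, 'i, 'j, 's, 'm) twisted_spinor
    \<Rightarrow> ('p, 'i, 'j, 's, 'm) twisted_spinor \<Rightarrow> complex" where
  "L2_ip M N \<mu> f u v = (LINT p|\<mu>. pt_ip M N f u v p)"

definition L2_sections ::
  "'n::finite \<Rightarrow> ('p::topological_space, 'i, 'n, 's::finite, 'y) spin_scheme
    \<Rightarrow> ('q, 'j, 'm::finite, 'z) riem_scheme \<Rightarrow> 'p measure \<Rightarrow> ('p \<Rightarrow> 'q)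
    \<Rightarrow> ('p, 'i, 'j, 's, 'm) twisted_spinor set" where
  "L2_sections k M N \<mu> f = {u \<in> rough_sections k M N f (bdry k M).
     (\<forall>i j. u i j \<in> borel_measurable borel) \<and> integrable \<mu> (pt_ip M N f u u)}"


section \<open>Sobolev spaces on the boundary\<close>

text \<open>Distributional sections of \<open>\<Sigma> \<otimes> f\<^sup>*TN\<close> over the boundary are conjugate-linear functionals on the
  smooth sections; a section \<open>u\<close> is the functional \<open>v \<mapsto> (u, v)\<close>. Functionals are set to zero on
  arguments which are not smooth sections.\<close>

type_synonym ('p, 'i, 'j, 's, 'm) distribution = "('p, 'i, 'j, 's, 'm) twisted_spinor \<Rightarrow> complex"

definition dist_of ::
  "'n::finite \<Rightarrow> ('p, 'i, 'n, 's::finite, 'y) spin_scheme \<Rightarrow> ('q, 'j, 'm::finite, 'z) riem_scheme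
    \<Rightarrow> 'p measure \<Rightarrow> ('p \<Rightarrow> 'q) \<Rightarrow> ('p, 'i, 'j, 's, 'm) twisted_spinor
    \<Rightarrow> ('p, 'i, 'j, 's, 'm) distribution" where
  "dist_of k M N \<mu> f u =
     (\<lambda>v. if v \<in> smooth_sections k M N f (bdry k M) then L2_ip M N \<mu> f u v else 0)"

definition bdry_restrict ::
  "'n::finite \<Rightarrow> ('p, 'i, 'n, 'y) riem_scheme \<Rightarrow> ('p, 'i, 'j, 's::finite, 'm::finite) twisted_spinor
    \<Rightarrow> ('p, 'i, 'j, 's, 'm) twisted_spinor" where
  "bdry_restrict k M \<phi> = (\<lambda>i j p. if p \<in> bdry k M then \<phi> i j p else 0)"

definition trace_of ::
  "'n::finite \<Rightarrow> ('p, 'i, 'n, 's::finite, 'y) spin_scheme \<Rightarrow> ('q, 'j, 'm::finite, 'z) riem_scheme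
    \<Rightarrow> 'p measure \<Rightarrow> ('p \<Rightarrow> 'q) \<Rightarrow> ('p, 'i, 'j, 's, 'm) twisted_spinor
    \<Rightarrow> ('p, 'i, 'j, 's, 'm) distribution" where
  "trace_of k M N \<mu> f \<phi> = dist_of k M N \<mu> f (bdry_restrict k M \<phi>)"

text \<open>Elements of the algebraic direct sum of the \<open>ker(A\<^sub>0 - l)\<close>, \<open>l \<in> I\<close>, are finitely
  supported families \<open>c\<close> with \<open>c l \<in> ker(A\<^sub>0 - l)\<close>.\<close>

definition eigen_sums ::
  "'n::finite \<Rightarrow> ('p, 'i, 'n, 's::finite, 'y) spin_scheme \<Rightarrow> ('q, 'j, 'm::finite, 'z) riem_scheme
    \<Rightarrow> ('p \<Rightarrow> 'q) \<Rightarrow> real set \<Rightarrow> (real \<Rightarrow> ('p, 'i, 'j, 's, 'm) twisted_spinor) set" where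
  "eigen_sums k M N f I = {c. (\<forall>l. c l \<in> A_0_kernel k M N f l) \<and>
     finite {l. c l \<noteq> (\<lambda>i j p. 0)} \<and> (\<forall>l. l \<notin> I \<longrightarrow> c l = (\<lambda>i j p. 0))}"

definition total ::
  "(real \<Rightarrow> ('p, 'i, 'j, 's::finite, 'm::finite) twisted_spinor)
    \<Rightarrow> ('p, 'i, 'j, 's, 'm) twisted_spinor" where
  "total c = (\<lambda>i j p. \<Sum>l | c l \<noteq> (\<lambda>i j p. 0). c l i j p)"

text \<open>The norm of \<open>H\<^sup>s\<close>, that is, the \<open>L\<^sup>2\<close>-norm of \<open>(1 + A\<^sub>0\<^sup>2)\<^sup>s\<^sup>/\<^sup>2\<close> applied to the element.\<close>

definition sobolev_norm ::
  "('p, 'i, 'n::finite, 's::finite, 'y) spin_scheme \<Rightarrow> ('q, 'j, 'm::finite, 'z) riem_scheme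
    \<Rightarrow> 'p measure \<Rightarrow> ('p \<Rightarrow> 'q) \<Rightarrow> real \<Rightarrow> (real \<Rightarrow> ('p, 'i, 'j, 's, 'm) twisted_spinor) \<Rightarrow> real" where
  "sobolev_norm M N \<mu> f s c =
     sqrt (\<Sum>l | c l \<noteq> (\<lambda>i j p. 0). (1 + l\<^sup>2) powr s * Re (L2_ip M N \<mu> f (c l) (c l)))"

text \<open>\<open>T\<close> is the limit of the \<open>H\<^sup>s\<close>-Cauchy sequence \<open>c\<close> of elements of the direct sum.\<close>

definition sobolev_limit ::
  "'n::finite \<Rightarrow> ('p, 'i, 'n, 's::finite, 'y) spin_scheme \<Rightarrow> ('q, 'j, 'm::finite, 'z) riem_scheme
    \<Rightarrow> 'p measure \<Rightarrow> ('p \<Rightarrow> 'q) \<Rightarrow> real \<Rightarrow> real set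
    \<Rightarrow> (nat \<Rightarrow> real \<Rightarrow> ('p, 'i, 'j, 's, 'm) twisted_spinor)
    \<Rightarrow> ('p, 'i, 'j, 's, 'm) distribution \<Rightarrow> bool" where
  "sobolev_limit k M N \<mu> f s I c T \<longleftrightarrow>
     (\<forall>n. c n \<in> eigen_sums k M N f I) \<and>
     (\<forall>e>0. \<exists>n0. \<forall>m\<ge>n0. \<forall>n\<ge>n0.
        sobolev_norm M N \<mu> f s (\<lambda>l i j p. c m l i j p - c n l i j p) < e) \<and>
     (\<forall>v\<in>smooth_sections k M N f (bdry k M). (\<lambda>n. L2_ip M N \<mu> f (total (c n)) v) \<longlonglongrightarrow> T v) \<and>
     (\<forall>v. v \<notin> smooth_sections k M N f (bdry k M) \<longrightarrow> T v = 0)"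

text \<open>\<open>H\<^sup>s\<^sub>I(A\<^sub>0)\<close>, and the \<open>H\<^sup>s\<close>-norm of its elements. The case \<open>I = UNIV\<close> is the full Sobolev space
  \<open>H\<^sup>s(\<partial>M, \<Sigma> \<otimes> f\<^sup>*TN)\<close>.\<close>

definition sobolev ::
  "'n::finite \<Rightarrow> ('p, 'i, 'n, 's::finite, 'y) spin_scheme \<Rightarrow> ('q, 'j, 'm::finite, 'z) riem_scheme
    \<Rightarrow> 'p measure \<Rightarrow> ('p \<Rightarrow> 'q) \<Rightarrow> real \<Rightarrow> real set \<Rightarrow> ('p, 'i, 'j, 's, 'm) distribution set" where
  "sobolev k M N \<mu> f s I = {T. \<exists>c. sobolev_limit k M N \<mu> f s I c T}"

definition sobolev_dist_norm ::
  "'n::finite \<Rightarrow> ('p, 'i, 'n, 's::finite, 'y) spin_scheme \<Rightarrow> ('q, 'j, 'm::finite, 'z) riem_scheme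
    \<Rightarrow> 'p measure \<Rightarrow> ('p \<Rightarrow> 'q) \<Rightarrow> real \<Rightarrow> real set \<Rightarrow> ('p, 'i, 'j, 's, 'm) distribution \<Rightarrow> real" where
  "sobolev_dist_norm k M N \<mu> f s I T = (THE r. \<exists>c. sobolev_limit k M N \<mu> f s I c T \<and>
     (\<lambda>n. sobolev_norm M N \<mu> f s (c n)) \<longlonglongrightarrow> r)"

definition check_H ::
  "'n::finite \<Rightarrow> ('p, 'i, 'n, 's::finite, 'y) spin_scheme \<Rightarrow> ('q, 'j, 'm::finite, 'z) riem_scheme
    \<Rightarrow> 'p measure \<Rightarrow> ('p \<Rightarrow> 'q) \<Rightarrow> real \<Rightarrow> ('p, 'i, 'j, 's, 'm) distribution set" where
  "check_H k M N \<mu> f a = {(\<lambda>v. S v + R v) | S R.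
     S \<in> sobolev k M N \<mu> f (1/2) {..<a} \<and> R \<in> sobolev k M N \<mu> f (-1/2) {a..}}"

text \<open>Convergence in the direct sum topology.\<close>

definition check_H_tendsto ::
  "'n::finite \<Rightarrow> ('p, 'i, 'n, 's::finite, 'y) spin_scheme \<Rightarrow> ('q, 'j, 'm::finite, 'z) riem_scheme
    \<Rightarrow> 'p measure \<Rightarrow> ('p \<Rightarrow> 'q) \<Rightarrow> real \<Rightarrow> (nat \<Rightarrow> ('p, 'i, 'j, 's, 'm) distribution)
    \<Rightarrow> ('p, 'i, 'j, 's, 'm) distribution \<Rightarrow> bool" where
  "check_H_tendsto k M N \<mu> f a Tn T \<longleftrightarrow> (\<exists>S R.
     (\<forall>n. S n \<in> sobolev k M N \<mu> f (1/2) {..<a} \<and> R n \<in> sobolev k M N \<mu> f (-1/2) {a..} \<and>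
          (\<forall>v. Tn n v - T v = S n v + R n v)) \<and>
     (\<lambda>n. sobolev_dist_norm k M N \<mu> f (1/2) {..<a} (S n)) \<longlonglongrightarrow> 0 \<and>
     (\<lambda>n. sobolev_dist_norm k M N \<mu> f (-1/2) {a..} (R n)) \<longlonglongrightarrow> 0)"

text \<open>The families \<open>c n\<close> of eigensections approximate \<open>T\<close> in \<open>check_H\<close>.\<close>

definition check_H_limit ::
  "'n::finite \<Rightarrow> ('p, 'i, 'n, 's::finite, 'y) spin_scheme \<Rightarrow> ('q, 'j, 'm::finite, 'z) riem_scheme
    \<Rightarrow> 'p measure \<Rightarrow> ('p \<Rightarrow> 'q) \<Rightarrow> real \<Rightarrow> (nat \<Rightarrow> real \<Rightarrow> ('p, 'i, 'j, 's, 'm) twisted_spinor)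
    \<Rightarrow> ('p, 'i, 'j, 's, 'm) distribution \<Rightarrow> bool" where
  "check_H_limit k M N \<mu> f a c T \<longleftrightarrow> (\<exists>S R.
     T = (\<lambda>v. S v + R v) \<and>
     sobolev_limit k M N \<mu> f (1/2) {..<a} (\<lambda>n l. if l < a then c n l else (\<lambda>i j p. 0)) S \<and>
     sobolev_limit k M N \<mu> f (-1/2) {a..} (\<lambda>n l. if a \<le> l then c n l else (\<lambda>i j p. 0)) R)"

text \<open>The continuous extension of \<open>(u, v) \<mapsto> (\<nu> \<cdot> u, v)\<close> from sums of eigensections to \<open>check_H\<close>.\<close>

definition normal_pairing ::
  "'n::finite \<Rightarrow> ('p, 'i, 'n, 's::finite, 'y) spin_scheme \<Rightarrow> ('q, 'j, 'm::finite, 'z) riem_scheme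
    \<Rightarrow> 'p measure \<Rightarrow> ('p \<Rightarrow> 'q) \<Rightarrow> real \<Rightarrow> ('p, 'i, 'j, 's, 'm) distribution
    \<Rightarrow> ('p, 'i, 'j, 's, 'm) distribution \<Rightarrow> complex" where
  "normal_pairing k M N \<mu> f a S T = (THE z. \<exists>c d.
     check_H_limit k M N \<mu> f a c S \<and> check_H_limit k M N \<mu> f a d T \<and>
     (\<lambda>n. L2_ip M N \<mu> f (normal_act k M (total (c n))) (total (d n))) \<longlonglongrightarrow> z)"


section \<open>Boundary conditions for spinors\<close>

definition boundary_condition ::
  "'n::finite \<Rightarrow> ('p, 'i, 'n, 's::finite, 'y) spin_scheme \<Rightarrow> ('q, 'j, 'm::finite, 'z) riem_scheme
    \<Rightarrow> 'p measure \<Rightarrow> ('p \<Rightarrow> 'q) \<Rightarrow> real \<Rightarrow> ('p, 'i, 'j, 's, 'm) distribution set \<Rightarrow> bool" where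
  "boundary_condition k M N \<mu> f a B \<longleftrightarrow> B \<subseteq> check_H k M N \<mu> f a \<and>
     (\<lambda>v. 0) \<in> B \<and> (\<forall>S\<in>B. \<forall>T\<in>B. (\<lambda>v. S v + T v) \<in> B) \<and> (\<forall>z. \<forall>T\<in>B. (\<lambda>v. z * T v) \<in> B) \<and>
     (\<forall>Tn T. (\<forall>n. Tn n \<in> B) \<and> T \<in> check_H k M N \<mu> f a \<and> check_H_tendsto k M N \<mu> f a Tn T \<longrightarrow> T \<in> B)"

definition adjoint_condition ::
  "'n::finite \<Rightarrow> ('p, 'i, 'n, 's::finite, 'y) spin_scheme \<Rightarrow> ('q, 'j, 'm::finite, 'z) riem_scheme
    \<Rightarrow> 'p measure \<Rightarrow> ('p \<Rightarrow> 'q) \<Rightarrow> real \<Rightarrow> ('p, 'i, 'j, 's, 'm) distribution set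
    \<Rightarrow> ('p, 'i, 'j, 's, 'm) distribution set" where
  "adjoint_condition k M N \<mu> f a B =
     {S \<in> check_H k M N \<mu> f a. \<forall>T\<in>B. normal_pairing k M N \<mu> f a S T = 0}"

definition elliptic_condition ::
  "'n::finite \<Rightarrow> ('p, 'i, 'n, 's::finite, 'y) spin_scheme \<Rightarrow> ('q, 'j, 'm::finite, 'z) riem_scheme
    \<Rightarrow> 'p measure \<Rightarrow> ('p \<Rightarrow> 'q) \<Rightarrow> real \<Rightarrow> ('p, 'i, 'j, 's, 'm) distribution set \<Rightarrow> bool" where
  "elliptic_condition k M N \<mu> f a B \<longleftrightarrow> boundary_condition k M N \<mu> f a B \<and>
     B \<subseteq> sobolev k M N \<mu> f (1/2) UNIV \<and>
     adjoint_condition k M N \<mu> f a B \<subseteq> sobolev k M N \<mu> f (1/2) UNIV"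

text \<open>The corresponding conditions for the maps \<open>f\<close> subject to the boundary condition \<open>bc\<close>, all
  denoted by the same letter: a condition \<open>B f\<close> for the Dirac operator along each such \<open>f\<close>, which
  only depends on the boundary values of \<open>f\<close>.\<close>

definition condition_family ::
  "'n::finite \<Rightarrow> ('p::topological_space, 'i, 'n, 's::finite, 'y) spin_scheme
    \<Rightarrow> ('q::topological_space, 'j, 'm::finite, 'z) riem_scheme \<Rightarrow> 'p measure \<Rightarrow> ('p, 'q) map_bc \<Rightarrow> real
    \<Rightarrow> (('p \<Rightarrow> 'q) \<Rightarrow> ('p, 'i, 'j, 's, 'm) distribution set) \<Rightarrow> bool" where
  "condition_family k M N \<mu> bc a B \<longleftrightarrow>
     (\<forall>f. smooth_map M N UNIV f \<and> satisfies_bc k M N bc f \<longrightarrow> boundary_condition k M N \<mu> f a (B f)) \<and>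
     (\<forall>f f'. smooth_map M N UNIV f \<and> satisfies_bc k M N bc f \<and>
             smooth_map M N UNIV f' \<and> satisfies_bc k M N bc f' \<and>
             (\<forall>p\<in>bdry k M. f p = f' p) \<longrightarrow> B f = B f')"

text \<open>Since an elliptic condition lies in \<open>H\<^sup>1\<^sup>/\<^sup>2 \<subseteq> L\<^sup>2\<close>, its elements are given by \<open>L\<^sup>2\<close>-sections, on
  which \<open>G \<otimes> id\<close> acts pointwise.\<close>

definition preserves_condition ::
  "'n::finite \<Rightarrow> ('p::topological_space, 'i, 'n, 's::finite, 'y) spin_scheme
    \<Rightarrow> ('q, 'j, 'm::finite, 'z) riem_scheme \<Rightarrow> 'p measure \<Rightarrow> ('p \<Rightarrow> 'q)
    \<Rightarrow> ('i \<Rightarrow> 'p \<Rightarrow> complex^'s \<Rightarrow> complex^'s) \<Rightarrow> ('p, 'i, 'j, 's, 'm) distribution set \<Rightarrow> bool" where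
  "preserves_condition k M N \<mu> f G B \<longleftrightarrow>
     (\<forall>u\<in>L2_sections k M N \<mu> f. dist_of k M N \<mu> f u \<in> B \<longrightarrow> dist_of k M N \<mu> f (tw_act M G u) \<in> B)"


section \<open>Variations\<close>

definition variation ::
  "'n::finite \<Rightarrow> ('p::topological_space, 'i, 'n, 's::finite, 'y) spin_scheme
    \<Rightarrow> ('q::topological_space, 'j, 'm::finite, 'z) riem_scheme \<Rightarrow> ('p, 'q) map_bc \<Rightarrow> real
    \<Rightarrow> (real \<Rightarrow> 'p \<Rightarrow> 'q) \<Rightarrow> (real \<Rightarrow> ('p, 'i, 'j, 's, 'm) twisted_spinor) \<Rightarrow> bool" where
  "variation k M N bc \<epsilon> F \<Phi> \<longleftrightarrow> \<epsilon> > 0 \<and>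
     continuous_on ({-\<epsilon><..<\<epsilon>} \<times> UNIV) (\<lambda>(t, p). F t p) \<and>
     (\<forall>i j. let A = {(t, x). t \<in> {-\<epsilon><..<\<epsilon>} \<and> x \<in> coord M i ` patch M i \<and>
                            F t (coord_inv M i x) \<in> patch N j} in
        smooth_on A (\<lambda>(t, x). coord N j (F t (coord_inv M i x))) \<and>
        smooth_on A (\<lambda>(t, x). \<Phi> t i j (coord_inv M i x))) \<and>
     (\<forall>t\<in>{-\<epsilon><..<\<epsilon>}. satisfies_bc k M N bc (F t) \<and> \<Phi> t \<in> smooth_sections k M N (F t) UNIV)"

text \<open>The covariant derivative of \<open>\<Phi>\<close> along \<open>\<partial>\<^sub>t\<close> at \<open>t = 0\<close>.\<close>

definition cov_dt ::
  "('p, 'i, 'n::finite, 's::finite, 'y) spin_scheme \<Rightarrow> ('q, 'j, 'm::finite, 'z) riem_scheme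
    \<Rightarrow> (real \<Rightarrow> 'p \<Rightarrow> 'q) \<Rightarrow> (real \<Rightarrow> ('p, 'i, 'j, 's, 'm) twisted_spinor)
    \<Rightarrow> ('p, 'i, 'j, 's, 'm) twisted_spinor" where
  "cov_dt M N F \<Phi> = (\<lambda>i j p.
     if p \<in> patch M i \<inter> F 0 -` patch N j
     then vector_derivative (\<lambda>t. \<Phi> t i j p) (at 0) +
       (\<chi> b. \<Sum>c\<in>UNIV. \<Sum>d\<in>UNIV. (christoffel UNIV N j (F 0 p) c d b *
          vector_derivative (\<lambda>t. coord N j (F t p)) (at 0) $ c) *\<^sub>R (\<Phi> 0 i j p $ d))
     else 0)"

definition variation_stable ::
  "'n::finite \<Rightarrow> ('p::topological_space, 'i, 'n, 's::finite, 'y) spin_scheme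
    \<Rightarrow> ('q::topological_space, 'j, 'm::finite, 'z) riem_scheme \<Rightarrow> 'p measure \<Rightarrow> ('p, 'q) map_bc
    \<Rightarrow> ('p \<Rightarrow> 'q) \<Rightarrow> (('p \<Rightarrow> 'q) \<Rightarrow> ('p, 'i, 'j, 's, 'm) distribution set) \<Rightarrow> bool" where
  "variation_stable k M N \<mu> bc f0 B \<longleftrightarrow>
     (\<forall>\<epsilon> F \<Phi>. variation k M N bc \<epsilon> F \<Phi> \<and> F 0 = f0 \<and>
        (\<forall>t\<in>{-\<epsilon><..<\<epsilon>}. trace_of k M N \<mu> (F t) (\<Phi> t) \<in> B (F t)) \<longrightarrow>
        trace_of k M N \<mu> f0 (cov_dt M N F \<Phi>) \<in> B f0)"


section \<open>Dirac-harmonic maps\<close>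

definition dirac_harmonic ::
  "'n::finite \<Rightarrow> ('p::topological_space, 'i, 'n, 's::finite, 'y) spin_scheme
    \<Rightarrow> ('q::topological_space, 'j, 'm::finite, 'z) riem_scheme \<Rightarrow> 'p measure \<Rightarrow> ('p, 'q) map_bc
    \<Rightarrow> ('p, 'i, 'j, 's, 'm) distribution set \<Rightarrow> ('p \<Rightarrow> 'q)
    \<Rightarrow> ('p, 'i, 'j, 's, 'm) twisted_spinor \<Rightarrow> bool" where
  "dirac_harmonic k M N \<mu> bc B f \<phi> \<longleftrightarrow> smooth_map M N UNIV f \<and>
     \<phi> \<in> dirac_kernel k M N f \<and>
     (\<forall>i j. \<forall>p\<in>patch M i \<inter> f -` patch N j.
        tension k M N f i j p = (1/2) *\<^sub>R V_field k M N f \<phi> i j p) \<and>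
     satisfies_bc k M N bc f \<and> trace_of k M N \<mu> f \<phi> \<in> B"

definition uncoupled ::
  "'n::finite \<Rightarrow> ('p, 'i, 'n, 's::finite, 'y) spin_scheme \<Rightarrow> ('q, 'j, 'm::finite, 'z) riem_scheme
    \<Rightarrow> ('p \<Rightarrow> 'q) \<Rightarrow> ('p, 'i, 'j, 's, 'm) twisted_spinor \<Rightarrow> bool" where
  "uncoupled k M N f \<phi> \<longleftrightarrow>
     (\<forall>i j. \<forall>p\<in>patch M i \<inter> f -` patch N j. V_field k M N f \<phi> i j p = 0)"

end

theory Submission
  imports Defs
begin

text \<open>The splitting is \<open>\<phi>\<^sub>\<plusminus> = (\<phi> \<plusminus> \<G>\<phi>) / 2\<close>. Since \<open>\<G>\<close> is parallel and anticommutes with Clifford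
  multiplication, \<open>D\<^sup>f\<close> exchanges the two chiralities, so that \<open>D\<^sup>f\<phi> = 0\<close> forces \<open>D\<^sup>f\<phi>\<^sub>+ = D\<^sup>f\<phi>\<^sub>- = 0\<close>.
  Moreover, \<open>V\<close> vanishes pointwise on sections of pure chirality: \<open>e\<^sub>j \<cdot> \<otimes> R\<close> maps \<open>\<Sigma>\<^sub>\<plusminus>M \<otimes> f\<^sup>*TN\<close> to
  \<open>\<Sigma>\<^sub>\<minusplus>M \<otimes> f\<^sup>*TN\<close>, and these are orthogonal because \<open>\<G>\<close> is symmetric. As \<open>f\<close> is harmonic, both sides of
  the equation for the tension field are therefore zero. The traces of \<open>\<phi>\<^sub>\<plusminus>\<close> are linear combinations
  of those of \<open>\<phi>\<close> and \<open>\<G>\<phi>\<close>, and \<open>B\<close> is a linear subspace preserved by \<open>\<G>\<close>; this only needs that the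
  trace of a smooth section is square-integrable, which is a matter of compactness.\<close>

section \<open>Calculus of smooth functions\<close>

lemma C_k_mono: "C_k r V f \<Longrightarrow> U \<subseteq> V \<Longrightarrow> C_k r U f"
  by (induction r arbitrary: f) (auto intro: continuous_on_subset)

text \<open>Openness of \<open>U\<close> matters: a Frechet derivative at a point of
  \<open>U\<close> depends on the values nearby, and these stay in \<open>U\<close>.\<close>

lemma C_k_cong:
  assumes "open U" "\<And>x. x \<in> U \<Longrightarrow> f x = g x"
  shows "C_k r U f \<Longrightarrow> C_k r U g"
  using assms(2)
proof (induction r arbitrary: f g)
  case 0
  then show ?case by (metis C_k.simps(1) continuous_on_cong)
next
  case (Suc r)
  have der: "(g has_derivative D) (at x)" if "x \<in> U" "(f has_derivative D) (at x)" for x D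
    using has_derivative_transform_within_open[OF that(2) assms(1) that(1)] Suc.prems(2) by simp
  have "g differentiable (at x)" if "x \<in> U" for x
    using Suc.prems(1) der[OF that] that unfolding C_k.simps differentiable_def by blast
  moreover have "frechet_derivative f (at x) = frechet_derivative g (at x)" if "x \<in> U" for x
  proof -
    have "(f has_derivative frechet_derivative f (at x)) (at x)"
      using Suc.prems(1) that by (auto simp: frechet_derivative_works)
    from der[OF that this] show ?thesis by (rule frechet_derivative_at)
  qed
  ultimately show ?case
    using Suc.prems(1) by (auto intro: Suc.IH)
qed

text \<open>In the product rule undifferentiated factors stand next to derivatives, so each factor
  is also needed at the lower order.\<close>

lemma C_k_Suc_imp: "C_k (Suc r) U f \<Longrightarrow> C_k r U f"
proof (induction r arbitrary: f)
  case 0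
  then show ?case
    by (auto simp: continuous_on_eq_continuous_within
        intro: differentiable_imp_continuous_within differentiable_within_subset)
next
  case (Suc r)
  from Suc.prems have d: "\<forall>x\<in>U. f differentiable (at x)"
    and e: "\<forall>v\<in>Basis. C_k (Suc r) U (\<lambda>x. frechet_derivative f (at x) v)"
    by simp_all
  from e have "\<forall>v\<in>Basis. C_k r U (\<lambda>x. frechet_derivative f (at x) v)"
    using Suc.IH by blast
  with d show ?case by simp
qed

lemma C_k_add:
  assumes "open U" "C_k r U f" "C_k r U g"
  shows "C_k r U (\<lambda>x. f x + g x)"
  using assms(2,3)
proof (induction r arbitrary: f g)
  case 0
  then show ?case by (auto intro: continuous_intros)
next
  case (Suc r)
  have D: "((\<lambda>x. f x + g x) has_derivative
      (\<lambda>v. frechet_derivative f (at x) v + frechet_derivative g (at x) v)) (at x)" if "x \<in> U" for x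
    using Suc.prems that by (intro has_derivative_add) (auto simp: frechet_derivative_works)
  have "C_k r U (\<lambda>x. frechet_derivative (\<lambda>x. f x + g x) (at x) v)" if "v \<in> Basis" for v
  proof (rule C_k_cong[OF assms(1)])
    show "C_k r U (\<lambda>x. frechet_derivative f (at x) v + frechet_derivative g (at x) v)"
      using Suc that by auto
    show "frechet_derivative f (at x) v + frechet_derivative g (at x) v =
        frechet_derivative (\<lambda>x. f x + g x) (at x) v" if "x \<in> U" for x
      using frechet_derivative_at[OF D[OF that]] by metis
  qed
  with D show ?case by (auto simp: differentiable_def)
qed

text \<open>By the Leibniz rule a derivative is a sum of two terms \<open>b\<close> of functions of
  lower order, hence the induction with \<open>f\<close> and \<open>g\<close> arbitrary.\<close>

lemma C_k_bilinear:
  assumes "open U" "bounded_bilinear b" "C_k r U f" "C_k r U g"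
  shows "C_k r U (\<lambda>x. b (f x) (g x))"
  using assms(3,4)
proof (induction r arbitrary: f g)
  case 0
  then show ?case by (auto intro: bounded_bilinear.continuous_on[OF assms(2)])
next
  case (Suc r)
  have D: "((\<lambda>x. b (f x) (g x)) has_derivative
      (\<lambda>v. b (f x) (frechet_derivative g (at x) v) + b (frechet_derivative f (at x) v) (g x))) (at x)"
    if "x \<in> U" for x
    using Suc.prems that
    by (intro bounded_bilinear.FDERIV[OF assms(2)]) (auto simp: frechet_derivative_works)
  have low: "C_k r U f" "C_k r U g"
    using Suc.prems C_k_Suc_imp by blast+
  have "C_k r U (\<lambda>x. frechet_derivative (\<lambda>x. b (f x) (g x)) (at x) v)" if "v \<in> Basis" for v
  proof (rule C_k_cong[OF assms(1)])
    show "C_k r U (\<lambda>x. b (f x) (frechet_derivative g (at x) v) + b (frechet_derivative f (at x) v) (g x))"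
      using Suc that low by (intro C_k_add[OF assms(1)] Suc.IH) auto
    show "b (f x) (frechet_derivative g (at x) v) + b (frechet_derivative f (at x) v) (g x) =
        frechet_derivative (\<lambda>x. b (f x) (g x)) (at x) v" if "x \<in> U" for x
      using frechet_derivative_at[OF D[OF that]] by metis
  qed
  with D show ?case by (auto simp: differentiable_def)
qed

lemma C_k_const: "C_k r U (\<lambda>x. c)"
  by (induction r arbitrary: c) (auto simp: frechet_derivative_const)

lemma C_k_bounded_linear:
  assumes "open U" "bounded_linear h" "C_k r U f"
  shows "C_k r U (\<lambda>x. h (f x))"
proof -
  interpret bounded_linear h by fact
  \<comment> \<open>A linear map is viewed as the bilinear map sending (s, x) to s h(x), with s
    frozen at 1, so that the Leibniz rule covers it.\<close>
  have "bounded_bilinear (\<lambda>(s::real) x. s *\<^sub>R h x)"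
    using bounded_bilinear.comp[OF bounded_bilinear_scaleR bounded_linear_ident assms(2)] by simp
  from C_k_bilinear[OF assms(1) this C_k_const[of r U 1] assms(3)] show ?thesis by simp
qed

section \<open>Smoothness on arbitrary sets through local extensions\<close>

lemma smooth_on_subset:
  assumes "smooth_on A f" "B \<subseteq> A"
  shows "smooth_on B f"
  unfolding smooth_on_def
proof
  fix x assume "x \<in> B"
  with assms obtain U g where "open U" "x \<in> U" "\<forall>r. C_k r U g" "\<forall>y\<in>A \<inter> U. g y = f y"
    unfolding smooth_on_def by (meson subsetD)
  with assms(2) show "\<exists>U g. open U \<and> x \<in> U \<and> (\<forall>r. C_k r U g) \<and> (\<forall>y\<in>B \<inter> U. g y = f y)"
    by (intro exI[of _ U] exI[of _ g]) auto
qed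

lemma smooth_on_cong:
  assumes "smooth_on A f" "\<And>x. x \<in> A \<Longrightarrow> f x = g x"
  shows "smooth_on A g"
  unfolding smooth_on_def
proof
  fix x assume "x \<in> A"
  with assms obtain U h where "open U" "x \<in> U" "\<forall>r. C_k r U h" "\<forall>y\<in>A \<inter> U. h y = f y"
    unfolding smooth_on_def by meson
  with assms(2) show "\<exists>U h. open U \<and> x \<in> U \<and> (\<forall>r. C_k r U h) \<and> (\<forall>y\<in>A \<inter> U. h y = g y)"
    by (intro exI[of _ U] exI[of _ h]) auto
qed

lemma smooth_on_const: "smooth_on A (\<lambda>x. c)"
  unfolding smooth_on_def
  by (intro ballI exI[of _ UNIV] exI[of _ "\<lambda>x. c"]) (auto simp: C_k_const)

text \<open>The extensions of \<open>f\<close> and \<open>g\<close> near a point live on different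
  neighbourhoods; they are combined on the intersection. Unary operations are the case
  \<open>f = g\<close>.\<close>

lemma smooth_on_combine:
  fixes A :: "'c::euclidean_space set"
  assumes "smooth_on A f" "smooth_on A g"
    and "\<And>(U :: 'c set) r f' g'. open U \<Longrightarrow> C_k r U f' \<Longrightarrow> C_k r U g' \<Longrightarrow> C_k r U (\<lambda>x. h (f' x) (g' x))"
  shows "smooth_on A (\<lambda>x. h (f x) (g x))"
  unfolding smooth_on_def
proof
  fix x assume "x \<in> A"
  with assms(1,2) obtain U f' V g' where U: "open U" "x \<in> U" "\<forall>r. C_k r U f'" "\<forall>y\<in>A \<inter> U. f' y = f y"
    and V: "open V" "x \<in> V" "\<forall>r. C_k r V g'" "\<forall>y\<in>A \<inter> V. g' y = g y"
    unfolding smooth_on_def by meson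
  have "\<forall>r. C_k r (U \<inter> V) (\<lambda>x. h (f' x) (g' x))"
  proof
    fix r
    have "C_k r (U \<inter> V) f'" "C_k r (U \<inter> V) g'"
      using U(3) V(3) C_k_mono[of r U f' "U \<inter> V"] C_k_mono[of r V g' "U \<inter> V"] by auto
    then show "C_k r (U \<inter> V) (\<lambda>x. h (f' x) (g' x))"
      by (rule assms(3)[OF open_Int[OF U(1) V(1)]])
  qed
  with U V show "\<exists>U g'. open U \<and> x \<in> U \<and> (\<forall>r. C_k r U g') \<and> (\<forall>y\<in>A \<inter> U. g' y = h (f y) (g y))"
    by (intro exI[of _ "U \<inter> V"] exI[of _ "\<lambda>x. h (f' x) (g' x)"]) auto
qed

lemma smooth_on_add: "smooth_on A f \<Longrightarrow> smooth_on A g \<Longrightarrow> smooth_on A (\<lambda>x. f x + g x)"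
  by (rule smooth_on_combine) (auto intro: C_k_add)

lemma smooth_on_bilinear:
  "bounded_bilinear b \<Longrightarrow> smooth_on A f \<Longrightarrow> smooth_on A g \<Longrightarrow> smooth_on A (\<lambda>x. b (f x) (g x))"
  by (rule smooth_on_combine[of A f g b]) (auto intro: C_k_bilinear)

lemma smooth_on_bounded_linear: "bounded_linear h \<Longrightarrow> smooth_on A f \<Longrightarrow> smooth_on A (\<lambda>x. h (f x))"
  by (rule smooth_on_combine[of A f f "\<lambda>x y. h x"]) (auto intro: C_k_bounded_linear)

lemma smooth_on_sum:
  "(\<And>i. i \<in> I \<Longrightarrow> smooth_on A (f i)) \<Longrightarrow> smooth_on A (\<lambda>x. \<Sum>i\<in>I. f i x)"
  by (induction I rule: infinite_finite_induct) (auto intro: smooth_on_const smooth_on_add)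

lemma smooth_on_scaleR: "smooth_on A f \<Longrightarrow> smooth_on A (\<lambda>x. r *\<^sub>R f x)"
  by (rule smooth_on_bounded_linear[OF bounded_linear_scaleR_right])

lemma bounded_linear_axis: "bounded_linear (axis i :: 'a::euclidean_space \<Rightarrow> 'a^'n::finite)"
  by (intro linear_conv_bounded_linear[THEN iffD1] linearI) (auto simp: vec_eq_iff axis_def)

lemma vec_lambda_eq_sum_axis:
  fixes h :: "'b::finite \<Rightarrow> 'a::euclidean_space"
  shows "(\<chi> b. h b) = (\<Sum>b\<in>UNIV. axis b (h b))"
  by (simp add: vec_eq_iff axis_def)

lemma smooth_on_vec_lambda:
  fixes f :: "'b::finite \<Rightarrow> 'c::euclidean_space \<Rightarrow> 'a::euclidean_space"
  assumes "\<And>b. smooth_on A (f b)"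
  shows "smooth_on A (\<lambda>x. \<chi> b. f b x)"
  unfolding vec_lambda_eq_sum_axis
  by (intro smooth_on_sum smooth_on_bounded_linear[OF bounded_linear_axis] assms)

lemma smooth_on_vec_nth: "smooth_on A f \<Longrightarrow> smooth_on A (\<lambda>x. f x $ b)"
  by (rule smooth_on_bounded_linear[OF bounded_linear_vec_nth])

text \<open>Expanding \<open>g x\<close> in the standard basis leaves only the maps from x to
  \<open>L x e\<close> with \<open>e\<close> fixed. This is the form in which
  \<open>spinor_endomorphism_field\<close> states smoothness of an endomorphism field.\<close>

lemma smooth_on_apply_linear:
  fixes g :: "'a::euclidean_space \<Rightarrow> 'b::euclidean_space" and L :: "'a \<Rightarrow> 'b \<Rightarrow> 'c::euclidean_space"
  assumes "smooth_on A g" "\<And>e. smooth_on A (\<lambda>x. L x e)" "\<And>x. x \<in> A \<Longrightarrow> linear (L x)"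
  shows "smooth_on A (\<lambda>x. L x (g x))"
proof (rule smooth_on_cong)
  show "smooth_on A (\<lambda>x. \<Sum>e\<in>Basis. (g x \<bullet> e) *\<^sub>R L x e)"
    by (intro smooth_on_sum smooth_on_bilinear[OF bounded_bilinear_scaleR] assms
        smooth_on_bounded_linear[OF bounded_linear_inner_left])
  show "(\<Sum>e\<in>Basis. (g x \<bullet> e) *\<^sub>R L x e) = L x (g x)" if "x \<in> A" for x
  proof -
    interpret linear "L x" using assms(3) that .
    have "L x (\<Sum>e\<in>Basis. (g x \<bullet> e) *\<^sub>R e) = (\<Sum>e\<in>Basis. (g x \<bullet> e) *\<^sub>R L x e)"
      by (simp only: sum scale)
    then show ?thesis by (simp only: euclidean_representation)
  qed
qed

text \<open>The derivative of a local extension also serves within \<open>A\<close>. For general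
  \<open>A\<close> it need not be unique, so only existence is claimed.\<close>

lemma smooth_on_imp_has_derivative:
  assumes "smooth_on A f" "x \<in> A"
  shows "\<exists>D. (f has_derivative D) (at x within A)"
proof -
  obtain U g where U: "open U" "x \<in> U" "C_k (Suc 0) U g" "\<forall>y\<in>A \<inter> U. g y = f y"
    using assms unfolding smooth_on_def by meson
  then obtain D where "(g has_derivative D) (at x within A)"
    unfolding C_k.simps differentiable_def using has_derivative_at_withinI by blast
  then have "(f has_derivative D) (at x within A)"
  proof (rule has_derivative_transform_eventually)
    show "\<forall>\<^sub>F y in at x within A. g y = f y"
      using U unfolding eventually_at_topological by blast
  qed (use U assms(2) in auto)
  then show ?thesis by blast
qed

lemma smooth_on_imp_continuous_on: "smooth_on A f \<Longrightarrow> continuous_on A f"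
  unfolding continuous_on_eq_continuous_within
proof
  fix x assume "smooth_on A f" "x \<in> A"
  then obtain D where "(f has_derivative D) (at x within A)"
    using smooth_on_imp_has_derivative by blast
  then show "continuous (at x within A) f" by (rule has_derivative_continuous)
qed

section \<open>Charts and partial derivatives\<close>

lemma
  assumes "riemannian_manifold H M"
  shows open_patch: "open (patch M i)"
    and coord_image_openin: "openin (top_of_set H) (coord M i ` patch M i)"
    and chart_homeomorphism:
      "homeomorphism (patch M i) (coord M i ` patch M i) (coord M i) (coord_inv M i)"
    and patch_cover: "\<exists>i. p \<in> patch M i"
proof -
  note M = assms[unfolded riemannian_manifold_def]
  note charts = M[THEN conjunct2, THEN conjunct1]
  have "(\<Union>i. patch M i) = UNIV" using M by (rule conjunct1)
  then show "\<exists>i. p \<in> patch M i" by blast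
  show "open (patch M i)" "openin (top_of_set H) (coord M i ` patch M i)"
    "homeomorphism (patch M i) (coord M i ` patch M i) (coord M i) (coord_inv M i)"
    using charts by simp_all
qed

lemma smooth_gmat: "riemannian_manifold H M \<Longrightarrow> smooth_in_chart M i UNIV (gmat M i)"
  unfolding riemannian_manifold_def by (elim conjE) (rule spec)

lemma gip_jac:
  assumes "riemannian_manifold H N" "q \<in> patch N j \<inter> patch N j'"
  shows "gip N j q u v = gip N j' q (jac H N j' j q *v u) (jac H N j' j q *v v)"
  using assms(1)[unfolded riemannian_manifold_def, THEN conjunct2, THEN conjunct2, THEN conjunct2,
      THEN conjunct2, THEN conjunct2, rule_format, OF assms(2)] .

lemma coord_mem_model:
  "riemannian_manifold H M \<Longrightarrow> p \<in> patch M i \<Longrightarrow> coord M i p \<in> H"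
  using openin_imp_subset[OF coord_image_openin, of H M i] by blast

lemma coord_inv_coord:
  "riemannian_manifold H M \<Longrightarrow> p \<in> patch M i \<Longrightarrow> coord_inv M i (coord M i p) = p"
  by (rule homeomorphism_apply1[OF chart_homeomorphism])

lemma openin_coord_image:
  assumes "riemannian_manifold H M" "open W" "W \<subseteq> patch M i"
  shows "openin (top_of_set H) (coord M i ` W)"
proof -
  have "openin (top_of_set (patch M i)) W"
    using assms(2,3) by (metis Int_absorb1 openin_open)
  from homeomorphism_imp_open_map[OF chart_homeomorphism[OF assms(1)] this]
  show ?thesis
    by (rule openin_trans[OF _ coord_image_openin[OF assms(1)]])
qed

text \<open>The chart image of \<open>W\<close> is relatively open in \<open>H\<close>, so a
  coordinate line through the point stays in it for all small \<open>t\<close> that keep the line in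
  \<open>H\<close>; these are the only values that the derivative sees.\<close>

lemma pd_cong:
  assumes M: "riemannian_manifold H M" and W: "open W" "W \<subseteq> patch M i" "p \<in> W"
    and eq: "\<And>q. q \<in> W \<Longrightarrow> F q = F' q"
  shows "pd H M i F p a = pd H M i F' p a"
proof -
  let ?x = "coord M i p"
  obtain T where T: "open T" "coord M i ` W = H \<inter> T"
    using openin_coord_image[OF M W(1,2)] by (auto simp: openin_open)
  have x: "?x \<in> H \<inter> T" using T(2) W(3) by blast
  have "open ((\<lambda>t. ?x + t *\<^sub>R axis a 1) -` T)"
    by (intro open_vimage T continuous_intros)
  then have "\<forall>\<^sub>F t in nhds 0. ?x + t *\<^sub>R axis a 1 \<in> T"
    using x by (auto simp: eventually_nhds intro!: exI[of _ "(\<lambda>t. ?x + t *\<^sub>R axis a 1) -` T"])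
  then have "\<forall>\<^sub>F t in nhds 0. t \<in> {t. ?x + t *\<^sub>R axis a 1 \<in> H} \<longrightarrow>
      (F \<circ> coord_inv M i) (?x + t *\<^sub>R axis a 1) = (F' \<circ> coord_inv M i) (?x + t *\<^sub>R axis a 1)"
  proof eventually_elim
    case (elim t)
    show ?case
    proof
      assume "t \<in> {t. ?x + t *\<^sub>R axis a 1 \<in> H}"
      with elim obtain q where "q \<in> W" "?x + t *\<^sub>R axis a 1 = coord M i q"
        using T(2) by blast
      then show "(F \<circ> coord_inv M i) (?x + t *\<^sub>R axis a 1) = (F' \<circ> coord_inv M i) (?x + t *\<^sub>R axis a 1)"
        using W(2) eq coord_inv_coord[OF M, of q i] by auto
    qed
  qed
  then show ?thesis
    unfolding pd_def dir_deriv_def using x by (intro vector_derivative_cong_eq) auto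
qed

text \<open>Moving in a positive coordinate direction never leaves the half space, even from the
  boundary. The filter being nontrivial makes the one-sided \<open>vector_derivative\<close>
  unique.\<close>

lemma half_space_direction_nontrivial:
  assumes "x \<in> half_space k"
  shows "at 0 within {t. x + t *\<^sub>R axis a 1 \<in> half_space k} \<noteq> bot"
proof -
  have "{0<..} \<subseteq> {t. x + t *\<^sub>R axis a 1 \<in> half_space k}"
    using assms by (auto simp: half_space_def axis_def)
  then have "at_right (0::real) \<le> at 0 within {t. x + t *\<^sub>R axis a 1 \<in> half_space k}"
    by (rule at_le)
  then show ?thesis
    by (metis bot.extremum_uniqueI trivial_limit_at_right_real)
qed

text \<open>Chain rule: the representative of \<open>F\<close> is differentiable within the half
  space, and the coordinate line is composed with it.\<close>

lemma pd_works:
  assumes M: "riemannian_manifold (half_space k) M" and W: "open W" "W \<subseteq> patch M i" "p \<in> W"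
    and F: "smooth_in_chart M i W F"
  shows "((\<lambda>t. (F \<circ> coord_inv M i) (coord M i p + t *\<^sub>R axis a 1)) has_vector_derivative
    pd (half_space k) M i F p a) (at 0 within {t. coord M i p + t *\<^sub>R axis a 1 \<in> half_space k})"
proof -
  let ?x = "coord M i p" and ?F = "F \<circ> coord_inv M i"
  let ?S = "{t. ?x + t *\<^sub>R axis a 1 \<in> half_space k}"
  have *: "W \<inter> patch M i = W" using W(2) by blast
  have xW: "?x \<in> coord M i ` W" using W(3) by blast
  obtain T where T: "open T" "coord M i ` W = half_space k \<inter> T"
    using openin_coord_image[OF M W(1,2)] by (auto simp: openin_open)
  obtain D where D: "(?F has_derivative D) (at ?x within coord M i ` W)"
    using smooth_on_imp_has_derivative[OF F[unfolded smooth_in_chart_def *] xW] by blast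
  \<comment> \<open>The image of \<open>W\<close> is a relative neighbourhood of the point, so it
    has the same filter as the whole half space, also at boundary points.\<close>
  have "at ?x within coord M i ` W = at ?x within half_space k"
    using T xW by (intro at_within_nhd[of _ T]) auto
  with D have D: "(?F has_derivative D) (at ?x within half_space k)" by simp
  then have "linear D" by (rule has_derivative_linear)
  have "((\<lambda>t. ?x + t *\<^sub>R axis a (1::real)) has_derivative (\<lambda>t. t *\<^sub>R axis a 1)) (at 0 within ?S)"
    by (auto intro!: derivative_eq_intros)
  then have "((\<lambda>t. ?F (?x + t *\<^sub>R axis a 1)) has_derivative (\<lambda>t. D (t *\<^sub>R axis a 1))) (at 0 within ?S)"
    by (rule has_derivative_in_compose) (use D in \<open>auto simp: o_def elim!: has_derivative_subset\<close>)
  then have D: "((\<lambda>t. ?F (?x + t *\<^sub>R axis a 1)) has_vector_derivative D (axis a 1)) (at 0 within ?S)"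
    by (simp add: has_vector_derivative_def linear_scale[OF \<open>linear D\<close>])
  have "?x \<in> half_space k" using T(2) xW by blast
  from vector_derivative_within[OF half_space_direction_nontrivial[OF this] D] D
  show ?thesis unfolding pd_def dir_deriv_def by simp
qed

lemma pd_eqI:
  assumes M: "riemannian_manifold (half_space k) M" and p: "p \<in> patch M i"
    and D: "((\<lambda>t. (F \<circ> coord_inv M i) (coord M i p + t *\<^sub>R axis a 1)) has_vector_derivative D)
      (at 0 within {t. coord M i p + t *\<^sub>R axis a 1 \<in> half_space k})"
  shows "pd (half_space k) M i F p a = D"
  unfolding pd_def dir_deriv_def
  using half_space_direction_nontrivial[OF coord_mem_model[OF M p]] D
  by (rule vector_derivative_within)

lemma pd_add:
  assumes "riemannian_manifold (half_space k) M" "open W" "W \<subseteq> patch M i" "p \<in> W"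
    and "smooth_in_chart M i W F" "smooth_in_chart M i W F'"
  shows "pd (half_space k) M i (\<lambda>q. F q + F' q) p a =
    pd (half_space k) M i F p a + pd (half_space k) M i F' p a"
  using assms has_vector_derivative_add[OF pd_works[OF assms(1-5)] pd_works[OF assms(1-4,6)]]
  by (intro pd_eqI) (auto simp: o_def)

lemma pd_scaleR:
  assumes "riemannian_manifold (half_space k) M" "open W" "W \<subseteq> patch M i" "p \<in> W"
    and "smooth_in_chart M i W F"
  shows "pd (half_space k) M i (\<lambda>q. r *\<^sub>R F q) p a = r *\<^sub>R pd (half_space k) M i F p a"
  using assms bounded_linear.has_vector_derivative[OF bounded_linear_scaleR_right pd_works[OF assms]]
  by (intro pd_eqI) (auto simp: o_def)

section \<open>The twisted Dirac operator and the chirality operator\<close>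

lemma linear_matrix_vector_mult_complex: "linear (\<lambda>x. (A :: complex^'s::finite^'t::finite) *v x)"
  by (intro linearI)
    (simp_all add: matrix_vector_mult_def vec_eq_iff scaleR_sum_right sum.distrib distrib_left)

lemmas mv_add = linear_add[OF linear_matrix_vector_mult_complex]
  and mv_scaleR = linear_scale[OF linear_matrix_vector_mult_complex]
  and mv_neg = linear_neg[OF linear_matrix_vector_mult_complex]

lemma spin_nabla_cong:
  assumes "riemannian_manifold (half_space k) M" "open W" "W \<subseteq> patch M i" "p \<in> W"
    and "\<And>q. q \<in> W \<Longrightarrow> \<psi> q = \<psi>' q"
  shows "spin_nabla k M i \<psi> p a = spin_nabla k M i \<psi>' p a"
  unfolding spin_nabla_def using pd_cong[OF assms] assms(4,5) by simp

lemma spin_nabla_add: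
  assumes "riemannian_manifold (half_space k) M" "open W" "W \<subseteq> patch M i" "p \<in> W"
    and "smooth_in_chart M i W \<psi>" "smooth_in_chart M i W \<psi>'"
  shows "spin_nabla k M i (\<lambda>q. \<psi> q + \<psi>' q) p a = spin_nabla k M i \<psi> p a + spin_nabla k M i \<psi>' p a"
  unfolding spin_nabla_def pd_add[OF assms]
  by (simp add: mv_add scaleR_add_right sum.distrib)

lemma spin_nabla_scaleR:
  assumes "riemannian_manifold (half_space k) M" "open W" "W \<subseteq> patch M i" "p \<in> W"
    and "smooth_in_chart M i W \<psi>"
  shows "spin_nabla k M i (\<lambda>q. r *\<^sub>R \<psi> q) p a = r *\<^sub>R spin_nabla k M i \<psi> p a"
  unfolding spin_nabla_def pd_scaleR[OF assms]
  by (simp add: mv_scaleR scaleR_add_right scaleR_sum_right mult.commute mult.left_commute)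

lemma smooth_section_components:
  assumes "\<phi> \<in> smooth_sections k M N f UNIV"
  shows "smooth_in_chart M i (patch M i \<inter> f -` patch N j) (\<lambda>q. \<phi> i j q $ b)"
proof -
  have "smooth_in_chart M i (f -` patch N j) (\<phi> i j)"
    using assms by (simp add: smooth_sections_def)
  then show ?thesis
    unfolding smooth_in_chart_def
    by (auto simp: o_def Int_commute dest: smooth_on_vec_nth[of _ _ b])
qed

lemma tw_nabla_add:
  assumes "riemannian_manifold (half_space k) M" "open (f -` patch N j)"
    and "p \<in> patch M i \<inter> f -` patch N j"
    and "\<phi> \<in> smooth_sections k M N f UNIV" "\<psi> \<in> smooth_sections k M N f UNIV"
  shows "tw_nabla k M N f (\<lambda>i j p. \<phi> i j p + \<psi> i j p) i j p a =
    tw_nabla k M N f \<phi> i j p a + tw_nabla k M N f \<psi> i j p a"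
  using spin_nabla_add[OF assms(1) open_Int[OF open_patch[OF assms(1)] assms(2)] Int_lower1 assms(3)
      smooth_section_components[OF assms(4)] smooth_section_components[OF assms(5)]]
  by (simp add: tw_nabla_def vec_eq_iff scaleR_add_right sum.distrib)

lemma dirac_add:
  assumes "riemannian_manifold (half_space k) M" "open (f -` patch N j)"
    and "p \<in> patch M i \<inter> f -` patch N j"
    and "\<phi> \<in> smooth_sections k M N f UNIV" "\<psi> \<in> smooth_sections k M N f UNIV"
  shows "dirac k M N f (\<lambda>i j p. \<phi> i j p + \<psi> i j p) i j p =
    dirac k M N f \<phi> i j p + dirac k M N f \<psi> i j p"
  unfolding dirac_def tw_nabla_add[OF assms]
  by (simp add: vec_eq_iff scaleR_add_right sum.distrib mv_add)

section \<open>The chirality operator, the connection and the Dirac operator\<close>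

lemma Re_cip: "Re (cip x y) = x \<bullet> y"
  by (simp add: cip_def inner_vec_def inner_complex_def)

text \<open>Both alternatives for \<open>G\<close> yield a real-linear map that is symmetric for the
  real inner product, the real part of \<open>cip\<close>. This allows a common treatment of the two
  cases.\<close>

lemma
  assumes "chirality_field k M G" "p \<in> patch M i"
  shows chirality_linear: "linear (G i p)"
    and chirality_symmetric: "G i p x \<bullet> y = x \<bullet> G i p y"
    and chirality_involution: "G i p (G i p x) = x"
    and chirality_cmul: "G i p (cmul M i p v *v x) = - (cmul M i p v *v G i p x)"
proof -
  have scale: "complex_of_real r *s x = r *\<^sub>R x" for r x
    by (simp add: vec_eq_iff flip: scaleR_conv_of_real)
  consider "real_symmetric (G i p)" | "complex_hermitian (G i p)"
    using assms unfolding chirality_field_def spinor_endomorphism_field_def by blast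
  then have "linear (G i p) \<and> (\<forall>x y. G i p x \<bullet> y = x \<bullet> G i p y)"
  proof cases
    case 1
    then show ?thesis by (simp add: real_symmetric_def Re_cip)
  next
    case 2
    then have "G i p (r *\<^sub>R x) = r *\<^sub>R G i p x" for r x
      unfolding complex_hermitian_def by (metis scale)
    with 2 show ?thesis
      unfolding complex_hermitian_def by (auto intro!: linearI simp flip: Re_cip)
  qed
  then show "linear (G i p)" "G i p x \<bullet> y = x \<bullet> G i p y" by blast+
  show "G i p (G i p x) = x" "G i p (cmul M i p v *v x) = - (cmul M i p v *v G i p x)"
    using assms by (auto simp: chirality_field_def)
qed

text \<open>The spin part commutes with \<open>G\<close> by parallelism. The Christoffel terms of
  \<open>N\<close> have real coefficients, through which the real-linear \<open>G i p\<close>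
  passes. The scalar \<open>s\<close> stands for either chirality.\<close>

lemma tw_nabla_chirality:
  assumes M: "riemannian_manifold (half_space k) M" and open_f: "open (f -` patch N j)"
    and p: "p \<in> patch M i \<inter> f -` patch N j"
    and G: "chirality_field k M G" and \<phi>: "\<phi> \<in> smooth_sections k M N f UNIV"
    and eig: "\<And>q b. q \<in> patch M i \<inter> f -` patch N j \<Longrightarrow> G i q (\<phi> i j q $ b) = s *\<^sub>R \<phi> i j q $ b"
  shows "G i p (tw_nabla k M N f \<phi> i j p a $ b) = s *\<^sub>R tw_nabla k M N f \<phi> i j p a $ b"
proof -
  let ?W = "patch M i \<inter> f -` patch N j"
  interpret linear "G i p" using chirality_linear[OF G] p by blast
  have W: "open ?W" "?W \<subseteq> patch M i" using open_patch[OF M] open_f by auto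
  have sm: "smooth_in_chart M i ?W (\<lambda>q. \<phi> i j q $ b)"
    by (rule smooth_section_components[OF \<phi>])
  have "G i p (spin_nabla k M i (\<lambda>q. \<phi> i j q $ b) p a) =
      spin_nabla k M i (\<lambda>q. G i q (\<phi> i j q $ b)) p a"
    using G W p sm unfolding chirality_field_def parallel_endomorphism_def by metis
  \<comment> \<open>Under the derivative the eigenvector equation is needed on the whole
    neighbourhood, not just at \<open>p\<close>.\<close>
  also have "\<dots> = spin_nabla k M i (\<lambda>q. s *\<^sub>R \<phi> i j q $ b) p a"
    using eig by (rule spin_nabla_cong[OF M W p])
  also have "\<dots> = s *\<^sub>R spin_nabla k M i (\<lambda>q. \<phi> i j q $ b) p a"
    by (rule spin_nabla_scaleR[OF M W p sm])
  finally show ?thesis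
    using eig[OF p] by (simp add: tw_nabla_def add scale sum scaleR_add_right scaleR_sum_right mult.commute)
qed

text \<open>The covariant derivatives keep the eigenvalue \<open>s\<close>, and the single Clifford
  multiplication in each summand changes its sign.\<close>

lemma dirac_chirality:
  assumes M: "riemannian_manifold (half_space k) M" and open_f: "open (f -` patch N j)"
    and p: "p \<in> patch M i \<inter> f -` patch N j"
    and G: "chirality_field k M G" and \<phi>: "\<phi> \<in> smooth_sections k M N f UNIV"
    and eig: "\<And>q b. q \<in> patch M i \<inter> f -` patch N j \<Longrightarrow> G i q (\<phi> i j q $ b) = s *\<^sub>R \<phi> i j q $ b"
  shows "G i p (dirac k M N f \<phi> i j p $ b) = - s *\<^sub>R dirac k M N f \<phi> i j p $ b"
proof -
  have i: "p \<in> patch M i" using p by blast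
  interpret linear "G i p" by (rule chirality_linear[OF G i])
  define X where "X l = (\<Sum>a\<in>UNIV. frame M i p l $ a *\<^sub>R tw_nabla k M N f \<phi> i j p a $ b)" for l
  have X: "G i p (X l) = s *\<^sub>R X l" for l
    unfolding X_def using tw_nabla_chirality[OF assms]
    by (simp add: sum scale scaleR_sum_right mult.commute)
  have "dirac k M N f \<phi> i j p $ b = (\<Sum>l\<in>UNIV. cmul M i p (frame M i p l) *v X l)"
    by (simp add: dirac_def X_def)
  then show ?thesis
    by (simp add: sum chirality_cmul[OF G i] X mv_scaleR scaleR_sum_right sum_negf)
qed

lemma dirac_kernel_chirality_parts:
  assumes M: "riemannian_manifold (half_space k) M" and open_f: "\<And>j. open (f -` patch N j)"
    and G: "chirality_field k M G" and \<phi>: "\<phi> \<in> dirac_kernel k M N f"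
    and split: "chirality_splitting k M N f G \<phi> \<phi>p \<phi>m"
  shows "\<phi>p \<in> dirac_kernel k M N f" "\<phi>m \<in> dirac_kernel k M N f"
proof -
  have sm: "\<phi>p \<in> smooth_sections k M N f UNIV" "\<phi>m \<in> smooth_sections k M N f UNIV"
    and \<phi>_eq: "\<phi> = (\<lambda>i j p. \<phi>p i j p + \<phi>m i j p)"
    using split by (simp_all add: chirality_splitting_def fun_eq_iff)
  have "dirac k M N f \<phi>p i j p = 0 \<and> dirac k M N f \<phi>m i j p = 0"
    if p: "p \<in> patch M i \<inter> f -` patch N j" for i j p
  proof -
    let ?P = "dirac k M N f \<phi>p i j p" and ?Q = "dirac k M N f \<phi>m i j p"
    interpret linear "G i p" using chirality_linear[OF G] p by blast
    have "?P + ?Q = 0"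
      using dirac_add[OF M open_f p sm] \<phi> p unfolding \<phi>_eq by (auto simp: dirac_kernel_def)
    then have Q: "?Q = - ?P" by (simp add: eq_neg_iff_add_eq_0 add.commute)
    have "G i p (?P $ b) = - 1 *\<^sub>R ?P $ b" for b
      using split by (intro dirac_chirality[OF M open_f p G sm(1)]) (auto simp: chirality_splitting_def)
    moreover have "G i p (?Q $ b) = - (- 1) *\<^sub>R ?Q $ b" for b
      using split by (intro dirac_chirality[OF M open_f p G sm(2)]) (auto simp: chirality_splitting_def)
    \<comment> \<open>\<open>?P\<close> lies in the eigenspace for -1 and \<open>?Q\<close> in that
      for 1. Since \<open>?Q = - ?P\<close>, the operator \<open>G i p\<close> both negates and
      fixes each component of \<open>?P\<close>.\<close>
    ultimately have "?P $ b = - (?P $ b)" for b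
      unfolding Q by (simp add: neg)
    then have "?P = 0" by (simp add: vec_eq_iff)
    with Q show ?thesis by simp
  qed
  with sm show "\<phi>p \<in> dirac_kernel k M N f" "\<phi>m \<in> dirac_kernel k M N f"
    by (auto simp: dirac_kernel_def)
qed

text \<open>Definiteness of the metric is what evaluates the definite description in
  \<open>V_field\<close> once its right-hand side vanishes.\<close>

lemma gip_zero_iff:
  assumes "riemannian_manifold H N" "q \<in> patch N j"
  shows "(\<forall>Y. gip N j q v Y = 0) \<longleftrightarrow> v = 0"
proof
  assume "\<forall>Y. gip N j q v Y = 0"
  then have "\<not> gip N j q v v > 0" by simp
  then show "v = 0" using assms unfolding riemannian_manifold_def by blast
qed (simp add: gip_def)

text \<open>Clifford multiplication maps \<open>\<Sigma>\<^sub>\<plusminus>M\<close> to \<open>\<Sigma>\<^sub>\<mp>M\<close>, which is orthogonal to it, and the curvature endomorphism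
  only acts on the other tensor factor.\<close>

lemma V_field_eq_0_if_chiral:
  assumes N: "riemannian_manifold H N" and j: "f p \<in> patch N j" and i: "p \<in> patch M i"
    and G: "chirality_field k M G" and s: "s \<noteq> 0"
    and eig: "\<And>b. G i p (\<phi> i j p $ b) = s *\<^sub>R \<phi> i j p $ b"
  shows "V_field k M N f \<phi> i j p = 0"
proof -
  have "(cmul M i p v *v \<phi> i j p $ c) \<bullet> \<phi> i j p $ b = 0" for v b c
  proof -
    \<comment> \<open>On the left \<open>G\<close> produces the factor \<open>- s\<close>, on the
      right the factor \<open>s\<close>; as \<open>s\<close> is nonzero, the product must
      vanish.\<close>
    have "G i p (cmul M i p v *v \<phi> i j p $ c) \<bullet> \<phi> i j p $ b = (cmul M i p v *v \<phi> i j p $ c) \<bullet> G i p (\<phi> i j p $ b)"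
      by (rule chirality_symmetric[OF G i])
    then show ?thesis
      using s by (simp add: chirality_cmul[OF G i] eig mv_scaleR)
  qed
  then have "Re (tw_ip N j (f p) (\<chi> b. \<Sum>c\<in>UNIV. A $ b $ c *\<^sub>R (cmul M i p v *v \<phi> i j p $ c)) (\<phi> i j p)) = 0"
    for A v
    by (simp add: tw_ip_def Re_cip inner_sum_left)
  then have "V_field k M N f \<phi> i j p = (THE v. \<forall>Y. gip N j (f p) v Y = 0)"
    unfolding V_field_def by simp
  then show ?thesis by (simp add: gip_zero_iff[OF N j])
qed

section \<open>Splitting sections by chirality\<close>

lemma rough_section_eq_0:
  "\<phi> \<in> rough_sections k M N f W \<Longrightarrow> p \<notin> W \<inter> patch M i \<inter> f -` patch N j \<Longrightarrow> \<phi> i j p = 0"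
  unfolding rough_sections_def by blast

lemma rough_section_transform:
  assumes "\<phi> \<in> rough_sections k M N f W"
    and "p \<in> W \<inter> patch M i \<inter> patch M i' \<inter> f -` (patch N j \<inter> patch N j')"
  shows "\<phi> i' j' p $ b =
    (\<Sum>c\<in>UNIV. jac UNIV N j' j (f p) $ b $ c *\<^sub>R (lift M i' i p *v \<phi> i j p $ c))"
  using assms unfolding rough_sections_def by blast

lemma smooth_section_rough: "\<phi> \<in> smooth_sections k M N f W \<Longrightarrow> \<phi> \<in> rough_sections k M N f W"
  by (simp add: smooth_sections_def)

lemma smooth_sections_linear_combination:
  assumes "\<phi> \<in> smooth_sections k M N f W" "\<psi> \<in> smooth_sections k M N f W"
  shows "(\<lambda>i j p. r *\<^sub>R \<phi> i j p + s *\<^sub>R \<psi> i j p) \<in> smooth_sections k M N f W"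
proof -
  have "(\<lambda>i j p. r *\<^sub>R \<phi> i j p + s *\<^sub>R \<psi> i j p) \<in> rough_sections k M N f W"
    unfolding rough_sections_def
  proof (rule CollectI, intro conjI allI ballI impI)
    fix i j p assume p: "p \<notin> W \<inter> patch M i \<inter> f -` patch N j"
    then have "\<phi> i j p = 0" "\<psi> i j p = 0"
      using assms[THEN smooth_section_rough] by (simp_all add: rough_section_eq_0)
    then show "r *\<^sub>R \<phi> i j p + s *\<^sub>R \<psi> i j p = 0" by simp
  next
    fix i i' j j' p b
    assume p: "p \<in> W \<inter> patch M i \<inter> patch M i' \<inter> f -` (patch N j \<inter> patch N j')"
    note tr = rough_section_transform[OF smooth_section_rough[OF assms(1)] p, of b]
      rough_section_transform[OF smooth_section_rough[OF assms(2)] p, of b]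
    show "(r *\<^sub>R \<phi> i' j' p + s *\<^sub>R \<psi> i' j' p) $ b = (\<Sum>c\<in>UNIV. jac UNIV N j' j (f p) $ b $ c *\<^sub>R
        (lift M i' i p *v (r *\<^sub>R \<phi> i j p + s *\<^sub>R \<psi> i j p) $ c))"
      by (simp add: tr mv_add mv_scaleR scaleR_add_right scaleR_sum_right sum.distrib mult.commute)
  qed
  moreover have "smooth_in_chart M i (W \<inter> f -` patch N j) (\<lambda>p. r *\<^sub>R \<phi> i j p + s *\<^sub>R \<psi> i j p)" for i j
    using assms unfolding smooth_sections_def smooth_in_chart_def o_def
    by (intro smooth_on_add smooth_on_scaleR) auto
  ultimately show ?thesis by (simp add: smooth_sections_def)
qed

text \<open>\<open>G\<close> commutes with the lifted transition functions and, being real-linear,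
  with the Jacobians of \<open>N\<close>, so the local representatives still fit together. Since
  \<open>G i p 0 = 0\<close>, the normalisation to zero outside the domain survives.\<close>

lemma tw_act_smooth_section:
  assumes M: "riemannian_manifold H M" and G: "chirality_field k M G"
    and \<phi>: "\<phi> \<in> smooth_sections k M N f W"
  shows "tw_act M G \<phi> \<in> smooth_sections k M N f W"
proof -
  note rough = smooth_section_rough[OF \<phi>]
  have "tw_act M G \<phi> \<in> rough_sections k M N f W"
    unfolding rough_sections_def
  proof (rule CollectI, intro conjI allI ballI impI)
    fix i j p assume p: "p \<notin> W \<inter> patch M i \<inter> f -` patch N j"
    show "tw_act M G \<phi> i j p = 0"
    proof (cases "p \<in> patch M i")
      case True
      then have "G i p 0 = 0" by (rule linear_0[OF chirality_linear[OF G]])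
      then show ?thesis by (simp add: tw_act_def rough_section_eq_0[OF rough p] vec_eq_iff)
    qed (simp add: tw_act_def)
  next
    fix i i' j j' p b
    assume p: "p \<in> W \<inter> patch M i \<inter> patch M i' \<inter> f -` (patch N j \<inter> patch N j')"
    note rough_section_transform[OF rough p, of b]
    moreover have "G i' p (lift M i' i p *v x) = lift M i' i p *v G i p x" for x
      using G p unfolding chirality_field_def spinor_endomorphism_field_def by blast
    moreover have "linear (G i' p)" using chirality_linear[OF G] p by blast
    ultimately show "tw_act M G \<phi> i' j' p $ b =
        (\<Sum>c\<in>UNIV. jac UNIV N j' j (f p) $ b $ c *\<^sub>R (lift M i' i p *v tw_act M G \<phi> i j p $ c))"
      using p by (simp add: tw_act_def linear_sum linear_scale)
  qed
  moreover have "smooth_in_chart M i (W \<inter> f -` patch N j) (tw_act M G \<phi> i j)" for i j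
    unfolding smooth_in_chart_def
  proof (rule smooth_on_cong)
    let ?A = "coord M i ` (W \<inter> f -` patch N j \<inter> patch M i)"
    have \<phi>': "smooth_on ?A (\<lambda>x. \<phi> i j (coord_inv M i x) $ b)" for b
      using \<phi> unfolding smooth_sections_def smooth_in_chart_def o_def
      by (intro smooth_on_vec_nth) auto
    have "smooth_on (coord M i ` (UNIV \<inter> patch M i)) (\<lambda>x. G i (coord_inv M i x) e)" for e
      using G unfolding chirality_field_def spinor_endomorphism_field_def smooth_in_chart_def o_def
      by blast
    then have G': "smooth_on ?A (\<lambda>x. G i (coord_inv M i x) e)" for e
      by (rule smooth_on_subset) (rule image_mono, simp)
    show "smooth_on ?A (\<lambda>x. \<chi> b. G i (coord_inv M i x) (\<phi> i j (coord_inv M i x) $ b))"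
    proof (rule smooth_on_vec_lambda, rule smooth_on_apply_linear[OF \<phi>' G'])
      show "linear (G i (coord_inv M i x))" if "x \<in> ?A" for x
        using that by (auto simp: coord_inv_coord[OF M] intro: chirality_linear[OF G])
    qed
    show "(\<chi> b. G i (coord_inv M i x) (\<phi> i j (coord_inv M i x) $ b)) = (tw_act M G \<phi> i j \<circ> coord_inv M i) x"
      if "x \<in> ?A" for x
      using that by (auto simp: tw_act_def coord_inv_coord[OF M])
  qed
  ultimately show ?thesis by (simp add: smooth_sections_def)
qed

lemma chirality_splitting_exists:
  assumes M: "riemannian_manifold H M" and G: "chirality_field k M G"
    and \<phi>: "\<phi> \<in> smooth_sections k M N f UNIV"
  shows "\<exists>\<phi>p \<phi>m. chirality_splitting k M N f G \<phi> \<phi>p \<phi>m"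
proof -
  define \<phi>p \<phi>m where "\<phi>p = (\<lambda>i j p. (1/2) *\<^sub>R \<phi> i j p + (1/2) *\<^sub>R tw_act M G \<phi> i j p)"
    and "\<phi>m = (\<lambda>i j p. (1/2) *\<^sub>R \<phi> i j p + (-1/2) *\<^sub>R tw_act M G \<phi> i j p)"
  have "\<phi>p \<in> smooth_sections k M N f UNIV" "\<phi>m \<in> smooth_sections k M N f UNIV"
    unfolding \<phi>p_def \<phi>m_def
    by (intro smooth_sections_linear_combination \<phi> tw_act_smooth_section[OF M G])+
  moreover have "\<phi> i j p = \<phi>p i j p + \<phi>m i j p" for i j p
    by (simp add: \<phi>p_def \<phi>m_def flip: scaleR_add_left)
  moreover have "G i p (\<phi>p i j p $ b) = \<phi>p i j p $ b \<and> G i p (\<phi>m i j p $ b) = - (\<phi>m i j p $ b)"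
    if "p \<in> patch M i" for i j p b
    using that chirality_involution[OF G that] chirality_linear[OF G that]
    by (simp add: \<phi>p_def \<phi>m_def tw_act_def linear_add linear_scale linear_diff linear_neg)
  ultimately show ?thesis
    unfolding chirality_splitting_def by blast
qed

text \<open>Stated for an arbitrary splitting, not just the one constructed above, because the
  theorem speaks of every splitting.\<close>

lemma tw_act_chirality_splitting:
  assumes G: "chirality_field k M G" and split: "chirality_splitting k M N f G \<phi> \<phi>p \<phi>m"
  shows "tw_act M G \<phi> i j p = \<phi>p i j p - \<phi>m i j p"
proof -
  note rough = split[unfolded chirality_splitting_def, THEN conjunct1, THEN smooth_section_rough]
    split[unfolded chirality_splitting_def, THEN conjunct2, THEN conjunct1, THEN smooth_section_rough]
  show ?thesis
  proof (cases "p \<in> patch M i")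
    case True
    have lin: "linear (G i p)" by (rule chirality_linear[OF G True])
    have sum: "\<phi> i j p = \<phi>p i j p + \<phi>m i j p"
      using split by (simp add: chirality_splitting_def)
    \<comment> \<open>The splitting gives the eigenvector equations only where \<open>f p\<close>
      lies in chart \<open>j\<close>; elsewhere both parts are zero by the normalisation of
      sections.\<close>
    have "G i p (\<phi>p i j p $ b) = \<phi>p i j p $ b \<and> G i p (\<phi>m i j p $ b) = - (\<phi>m i j p $ b)" for b
    proof (cases "f p \<in> patch N j")
      case True
      then show ?thesis using split \<open>p \<in> patch M i\<close> by (simp add: chirality_splitting_def)
    next
      case False
      then have "\<phi>p i j p = 0" "\<phi>m i j p = 0" using rough by (simp_all add: rough_section_eq_0)
      then show ?thesis by (simp add: linear_0[OF lin])
    qed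
    then show ?thesis
      using True by (simp add: tw_act_def sum linear_add[OF lin] vec_eq_iff)
  next
    case False
    then have "\<phi>p i j p = 0" "\<phi>m i j p = 0" using rough by (simp_all add: rough_section_eq_0)
    with False show ?thesis by (simp add: tw_act_def)
  qed
qed

section \<open>The boundary and its measure\<close>

text \<open>By invariance of domain, a transition map of the atlas cannot move an interior point of the half
  space to the bounding hyperplane.\<close>

lemma bdry_iff:
  assumes M: "riemannian_manifold (half_space k) M" and p: "p \<in> patch M i"
  shows "p \<in> bdry k M \<longleftrightarrow> coord M i p $ k = 0"
proof
  assume "p \<in> bdry k M"
  then obtain j where j: "p \<in> patch M j" "coord M j p $ k = 0"
    by (auto simp: bdry_def)
  show "coord M i p $ k = 0"
  proof (rule ccontr)
    assume nz: "coord M i p $ k \<noteq> 0"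
    let ?W = "patch M i \<inter> patch M j"
    \<comment> \<open>Removing the bounding hyperplane makes \<open>U\<close> open in the whole
      Euclidean space, as invariance of domain requires.\<close>
    define U where "U = coord M i ` ?W \<inter> {x. x $ k > 0}"
    have "openin (top_of_set (half_space k)) (coord M i ` ?W)"
      using open_patch[OF M] by (intro openin_coord_image[OF M]) auto
    then obtain T where T: "open T" "coord M i ` ?W = half_space k \<inter> T"
      by (auto simp: openin_open)
    then have "U = T \<inter> {x. x $ k > 0}"
      by (auto simp: U_def half_space_def)
    moreover have "open {x :: real^'a. x $ k > 0}"
      by (intro open_Collect_less continuous_intros)
    ultimately have "open U" using T(1) by auto
    have "coord M i p \<in> half_space k" using coord_mem_model[OF M p] .
    with nz have pU: "coord M i p \<in> U" using p j(1) by (auto simp: U_def half_space_def)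
    have inv: "coord_inv M i x \<in> ?W" "coord M i (coord_inv M i x) = x" if "x \<in> U" for x
      using that by (auto simp: U_def coord_inv_coord[OF M])
    let ?h = "coord M j \<circ> coord_inv M i"
    have "continuous_on U ?h"
    proof (rule continuous_on_compose)
      show "continuous_on U (coord_inv M i)"
        using homeomorphism_cont2[OF chart_homeomorphism[OF M]]
        by (rule continuous_on_subset) (auto simp: U_def)
      show "continuous_on (coord_inv M i ` U) (coord M j)"
        using homeomorphism_cont1[OF chart_homeomorphism[OF M]]
        by (rule continuous_on_subset) (use inv in auto)
    qed
    moreover have "inj_on ?h U"
    proof (rule inj_onI)
      fix x y assume xy: "x \<in> U" "y \<in> U" "?h x = ?h y"
      then have "coord_inv M i x = coord_inv M i y"
        using inv(1)[OF xy(1)] inv(1)[OF xy(2)] coord_inv_coord[OF M, of _ j]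
        by (metis IntD2 comp_apply)
      then show "x = y" using inv(2) xy by metis
    qed
    ultimately have "open (?h ` U)"
      using \<open>open U\<close> by (intro invariance_of_domain)
    moreover have "coord M j p \<in> ?h ` U"
      using pU coord_inv_coord[OF M p] by (auto intro!: image_eqI[of _ _ "coord M i p"])
    ultimately obtain e where e: "e > 0" "ball (coord M j p) e \<subseteq> ?h ` U"
      by (meson openE)
    \<comment> \<open>The open image of \<open>U\<close> contains a point of the hyperplane, hence
      also points slightly below it, but chart \<open>j\<close> only takes values in the half
      space.\<close>
    have "coord M j p - (e/2) *\<^sub>R axis k 1 \<in> ball (coord M j p) e"
      using e(1) by (simp add: dist_norm norm_axis_1)
    with e(2) have "coord M j p - (e/2) *\<^sub>R axis k 1 \<in> ?h ` U" by (rule subsetD)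
    then obtain x where x: "coord M j p - (e/2) *\<^sub>R axis k 1 = ?h x" "x \<in> U" by (rule imageE)
    have "coord M j p - (e/2) *\<^sub>R axis k 1 \<in> half_space k"
      unfolding x(1) using coord_mem_model[OF M, of "coord_inv M i x" j] inv(1)[OF x(2)] by simp
    then show False using j(2) e(1) by (simp add: half_space_def axis_def)
  qed
qed (use p in \<open>auto simp: bdry_def\<close>)

text \<open>By \<open>bdry_iff\<close> any single chart decides membership, so the complement is the
  union of the open sets where the \<open>k\<close>-th coordinate is nonzero.\<close>

lemma closed_bdry:
  fixes M :: "('p::{t2_space,second_countable_topology}, 'i, 'n::finite, 'z) riem_scheme"
  assumes M: "riemannian_manifold (half_space k) M"
  shows "closed (bdry k M)"
proof -
  have "open {p \<in> patch M i. coord M i p $ k \<noteq> 0}" for i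
  proof -
    have "continuous_on (patch M i) (\<lambda>p. coord M i p $ k)"
      by (intro continuous_intros homeomorphism_cont1[OF chart_homeomorphism[OF M]])
    then have "open ((\<lambda>p. coord M i p $ k) -` (- {0}) \<inter> patch M i)"
      using open_patch[OF M] by (subst (asm) continuous_on_open_vimage) auto
    then show ?thesis by (simp add: vimage_def Int_def conj_commute)
  qed
  moreover have "- bdry k M = (\<Union>i. {p \<in> patch M i. coord M i p $ k \<noteq> 0})"
    using patch_cover[OF M] bdry_iff[OF M] by blast
  ultimately show ?thesis unfolding closed_def by auto
qed

text \<open>In the coordinates other than \<open>k\<close>, the part of the hyperplane inside the
  ball lies in a box, whose product measure is a finite product of finite lengths.\<close>

lemma emeasure_hyperplane_measure_ball_finite:
  "emeasure (hyperplane_measure k) (ball x e) < \<infinity>"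
proof -
  interpret P: product_sigma_finite "\<lambda>_::'a. lborel :: real measure"
    by unfold_locales
  let ?P = "\<Pi>\<^sub>M a\<in>-{k}. (lborel :: real measure)"
  let ?g = "\<lambda>y. (\<chi> a. if a = k then 0 else y a) :: real^'a"
  have meas: "?g \<in> borel_measurable ?P"
  proof (subst borel_measurable_euclidean_space, safe)
    fix b :: "real^'a" assume "b \<in> Basis"
    then obtain a where b: "b = axis a 1" by (auto simp: Basis_vec_def)
    show "(\<lambda>y. ?g y \<bullet> b) \<in> borel_measurable ?P"
      by (cases "a = k") (auto simp: b inner_axis)
  qed
  let ?B = "Pi\<^sub>E (-{k}) (\<lambda>a. {x $ a - e .. x $ a + e})"
  have "emeasure (hyperplane_measure k) (ball x e) = emeasure ?P (?g -` ball x e \<inter> space ?P)"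
    unfolding hyperplane_measure_def by (rule emeasure_distr[OF meas]) simp
  also have "\<dots> \<le> emeasure ?P ?B"
  proof (rule emeasure_mono)
    show "?g -` ball x e \<inter> space ?P \<subseteq> ?B"
    proof
      fix y assume y: "y \<in> ?g -` ball x e \<inter> space ?P"
      have "y a \<in> {x $ a - e .. x $ a + e}" if "a \<in> -{k}" for a
      proof -
        have "\<bar>(x - ?g y) $ a\<bar> \<le> norm (x - ?g y)" by (rule component_le_norm_cart)
        also have "\<dots> < e" using y by (simp add: dist_norm)
        finally show ?thesis using that by auto
      qed
      moreover have "y \<in> extensional (-{k})" using y by (auto simp: space_PiM PiE_def)
      ultimately show "y \<in> ?B" by (auto simp: PiE_def)
    qed
    show "?B \<in> sets ?P" by (intro sets_PiM_I_finite) auto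
  qed
  also have "\<dots> = (\<Prod>a\<in>-{k}. emeasure lborel {x $ a - e .. x $ a + e})"
    by (intro P.emeasure_PiM) auto
  also have "\<dots> < \<infinity>"
    by (auto simp: less_top[symmetric] ennreal_prod_eq_top emeasure_lborel_Icc_eq)
  finally show ?thesis .
qed

lemma continuous_on_chart:
  assumes M: "riemannian_manifold H M" and F: "smooth_in_chart M i W F"
  shows "continuous_on (W \<inter> patch M i) F"
proof -
  have "continuous_on (W \<inter> patch M i) ((F \<circ> coord_inv M i) \<circ> coord M i)"
  proof (rule continuous_on_compose)
    show "continuous_on (W \<inter> patch M i) (coord M i)"
      using homeomorphism_cont1[OF chart_homeomorphism[OF M]] by (rule continuous_on_subset) simp
    show "continuous_on (coord M i ` (W \<inter> patch M i)) (F \<circ> coord_inv M i)"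
      using F unfolding smooth_in_chart_def by (rule smooth_on_imp_continuous_on)
  qed
  then show ?thesis
    by (rule continuous_on_eq) (simp add: coord_inv_coord[OF M])
qed

text \<open>The measure is locally finite, because its density is continuous in charts; by
  compactness finitely many neighbourhoods of finite measure cover the manifold.\<close>

lemma finite_bdry_measure:
  fixes M :: "('p::{t2_space,second_countable_topology}, 'i, 'n::finite, 'z) riem_scheme"
  assumes M: "riemannian_manifold (half_space k) M" and compact: "compact (UNIV :: 'p set)"
    and \<mu>: "bdry_measure k M \<mu>"
  shows "finite_measure \<mu>"
proof -
  have sets: "sets \<mu> = sets borel" using \<mu> by (simp add: bdry_measure_def)
  have "\<exists>A. open A \<and> p \<in> A \<and> emeasure \<mu> A < \<infinity>" for p
  proof -
    obtain i where i: "p \<in> patch M i" using patch_cover[OF M] by blast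
    let ?x = "coord M i p" and ?H = "half_space k"
    let ?\<rho> = "\<lambda>y. bdry_density k M i (coord_inv M i y)"
    obtain T where T: "open T" "coord M i ` patch M i = ?H \<inter> T"
      using coord_image_openin[OF M] by (auto simp: openin_open)
    have x: "?x \<in> ?H \<inter> T" using T(2) i by blast
    then obtain e where e: "e > 0" "cball ?x e \<subseteq> T"
      using T(1) by (meson IntD2 open_contains_cball)
    \<comment> \<open>The density is bounded on this compact half-ball. The neighbourhood of finite
      measure is the chart preimage \<open>?A\<close> of the open ball.\<close>
    let ?K = "cball ?x e \<inter> ?H"
    have K: "?K \<subseteq> coord M i ` patch M i" using e(2) T(2) by blast
    have "closed ?H"
      unfolding half_space_def by (intro closed_Collect_le continuous_intros)
    then have "compact ?K" by (intro compact_Int_closed) auto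
    moreover have "continuous_on ?K ?\<rho>"
    proof -
      have "continuous_on (coord M i ` (UNIV \<inter> patch M i)) (gmat M i \<circ> coord_inv M i)"
        using smooth_gmat[OF M] unfolding smooth_in_chart_def by (rule smooth_on_imp_continuous_on)
      then have g: "continuous_on ?K (\<lambda>y. gmat M i (coord_inv M i y))"
        using K by (auto simp: o_def elim: continuous_on_subset)
      define m where "m y = (\<chi> a b. if a = k \<or> b = k then (if a = b then 1 else 0)
          else gmat M i (coord_inv M i y) $ a $ b)" for y
      have m: "continuous_on ?K (\<lambda>y. m y $ a $ b)" for a b
        by (cases "a = k \<or> b = k") (auto simp: m_def intro!: continuous_intros g)
      have "continuous_on ?K (\<lambda>y. det (m y))"
        unfolding det_def
        by (intro continuous_on_sum continuous_on_prod continuous_on_mult continuous_on_const m)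
      then show ?thesis unfolding bdry_density_def m_def by (rule continuous_on_real_sqrt)
    qed
    ultimately have "bounded (?\<rho> ` ?K)"
      by (intro compact_imp_bounded compact_continuous_image)
    then obtain C where C: "\<And>y. y \<in> ?K \<Longrightarrow> ?\<rho> y \<le> C"
      unfolding bounded_iff by (metis abs_le_D1 image_eqI real_norm_def)
    let ?A = "{q \<in> patch M i. coord M i q \<in> ball ?x e}"
    have "open (coord M i -` ball ?x e \<inter> patch M i)"
      using homeomorphism_cont1[OF chart_homeomorphism[OF M]] open_patch[OF M]
      by (subst (asm) continuous_on_open_vimage) auto
    moreover have "coord M i -` ball ?x e \<inter> patch M i = ?A" by auto
    ultimately have "open ?A" by simp
    have "emeasure \<mu> ?A = (\<integral>\<^sup>+ y. ennreal (?\<rho> y) * indicator (coord M i ` (?A \<inter> bdry k M)) y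
        \<partial>hyperplane_measure k)"
      using \<mu> \<open>open ?A\<close> by (simp add: bdry_measure_def)
    also have "\<dots> \<le> (\<integral>\<^sup>+ y. ennreal C * indicator (ball ?x e) y \<partial>hyperplane_measure k)"
    proof (rule nn_integral_mono)
      fix y
      show "ennreal (?\<rho> y) * indicator (coord M i ` (?A \<inter> bdry k M)) y \<le> ennreal C * indicator (ball ?x e) y"
      proof (cases "y \<in> coord M i ` (?A \<inter> bdry k M)")
        case True
        then have "y \<in> ball ?x e" "y \<in> ?H"
          using coord_mem_model[OF M] by auto
        then show ?thesis
          using C[of y] True by (auto intro: ennreal_leI)
      qed simp
    qed
    also have "\<dots> = ennreal C * emeasure (hyperplane_measure k) (ball ?x e)"
      by (rule nn_integral_cmult_indicator) (simp add: hyperplane_measure_def)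
    also have "\<dots> < \<infinity>"
      using emeasure_hyperplane_measure_ball_finite[of k ?x e] by (simp add: ennreal_mult_less_top)
    finally show ?thesis
      using \<open>open ?A\<close> i e(1) by (intro exI[of _ ?A]) auto
  qed
  then obtain A where A: "\<And>p. open (A p) \<and> p \<in> A p \<and> emeasure \<mu> (A p) < \<infinity>" by metis
  obtain D where D: "finite D" "UNIV \<subseteq> (\<Union>p\<in>D. A p)"
    using compactE_image[OF compact, of UNIV A] A by (metis UNIV_I UN_I subsetI)
  have "emeasure \<mu> (space \<mu>) \<le> emeasure \<mu> (\<Union>p\<in>D. A p)"
    using D A sets by (intro emeasure_mono sets.finite_UN) auto
  also have "\<dots> \<le> (\<Sum>p\<in>D. emeasure \<mu> (A p))"
    using D A sets by (intro emeasure_subadditive_finite) auto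
  also have "\<dots> < \<infinity>" using D A by (simp add: less_top)
  finally show ?thesis by (intro finite_measureI) auto
qed

section \<open>The pointwise product and traces\<close>

text \<open>Conjugation in the second argument is real-linear, so the Hermitian product is bilinear
  over the reals.\<close>

lemma bounded_bilinear_cip: "bounded_bilinear (cip :: complex^'s::finite \<Rightarrow> complex^'s \<Rightarrow> complex)"
  unfolding bilinear_conv_bounded_bilinear[symmetric] bilinear_def
  by (auto intro!: linearI simp: cip_def sum.distrib distrib_left distrib_right scaleR_sum_right)

lemmas cip_simps = bounded_bilinear.sum_left[OF bounded_bilinear_cip]
  bounded_bilinear.sum_right[OF bounded_bilinear_cip]
  bounded_bilinear.scaleR_left[OF bounded_bilinear_cip]
  bounded_bilinear.scaleR_right[OF bounded_bilinear_cip]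
  bounded_bilinear.add_left[OF bounded_bilinear_cip]
  bounded_bilinear.minus_left[OF bounded_bilinear_cip]
  bounded_bilinear.minus_right[OF bounded_bilinear_cip]
  bounded_bilinear.diff_left[OF bounded_bilinear_cip]

section \<open>Clifford multiplication and the unitary action of the spin group\<close>

lemma linear_mv_left: "linear (\<lambda>A. (A :: complex^'s::finite^'t::finite) *v x)"
  by (intro linearI)
    (simp_all add: matrix_vector_mult_def vec_eq_iff scaleR_sum_right sum.distrib distrib_right)

lemma clif_vec_mv: "clif_vec \<gamma> v *v x = (\<Sum>a\<in>UNIV. v $ a *\<^sub>R (\<gamma> a *v x))"
  by (simp add: clif_vec_def linear_sum[OF linear_mv_left] linear_scale[OF linear_mv_left])

lemma cip_clif_vec:
  assumes "spinor_module \<gamma>"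
  shows "cip (clif_vec \<gamma> v *v x) y = - cip x (clif_vec \<gamma> v *v y)"
proof -
  have "cip (\<gamma> a *v x) y = - cip x (\<gamma> a *v y)" for a
    using assms unfolding spinor_module_def by blast
  then show ?thesis by (simp add: clif_vec_mv cip_simps sum_negf)
qed

text \<open>The double sum is added to itself with the two indices exchanged. This turns products of
  generators into anticommutators, of which only the diagonal ones remain.\<close>

lemma clif_vec_square:
  assumes "spinor_module \<gamma>"
  shows "clif_vec \<gamma> v *v (clif_vec \<gamma> v *v x) = - (v \<bullet> v) *\<^sub>R x"
proof -
  let ?t = "\<lambda>a b. (v $ a * v $ b) *\<^sub>R (\<gamma> a *v (\<gamma> b *v x))"
  have S: "clif_vec \<gamma> v *v (clif_vec \<gamma> v *v x) = (\<Sum>a\<in>UNIV. \<Sum>b\<in>UNIV. ?t a b)"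
    by (subst sum.swap)
      (simp add: clif_vec_mv linear_sum[OF linear_matrix_vector_mult_complex] mv_scaleR scaleR_sum_right
        mult.commute)
  have anti: "\<gamma> a *v (\<gamma> b *v x) + \<gamma> b *v (\<gamma> a *v x) = (if a = b then -2 *\<^sub>R x else 0)" for a b
  proof -
    have "\<gamma> a ** \<gamma> b + \<gamma> b ** \<gamma> a = (if a = b then -2 *\<^sub>R mat 1 else 0)"
      using assms unfolding spinor_module_def by blast
    then have "(\<gamma> a ** \<gamma> b + \<gamma> b ** \<gamma> a) *v x = (if a = b then -2 *\<^sub>R mat 1 else 0) *v x"
      by (rule arg_cong)
    then show ?thesis
      by (simp add: matrix_vector_mul_assoc linear_add[OF linear_mv_left] linear_neg[OF linear_mv_left]
          linear_scale[OF linear_mv_left] split: if_splits)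
  qed
  have "(\<Sum>a\<in>UNIV. \<Sum>b\<in>UNIV. ?t a b) + (\<Sum>a\<in>UNIV. \<Sum>b\<in>UNIV. ?t a b) =
      (\<Sum>a\<in>UNIV. \<Sum>b\<in>UNIV. ?t a b) + (\<Sum>a\<in>UNIV. \<Sum>b\<in>UNIV. ?t b a)"
    by (subst (2) sum.swap) simp
  also have "\<dots> = (\<Sum>a\<in>UNIV. \<Sum>b\<in>UNIV. (v $ a * v $ b) *\<^sub>R (\<gamma> a *v (\<gamma> b *v x) + \<gamma> b *v (\<gamma> a *v x)))"
    by (simp add: scaleR_add_right mult.commute flip: sum.distrib)
  also have "\<dots> = (\<Sum>a\<in>UNIV. (v $ a * v $ a) *\<^sub>R (-2 *\<^sub>R x))"
    unfolding anti by (simp add: if_distrib[of "\<lambda>y. _ *\<^sub>R y"] sum.delta cong: if_cong)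
  also have "\<dots> = (-2) *\<^sub>R (v \<bullet> v) *\<^sub>R x"
    by (simp add: inner_vec_def scaleR_sum_left scaleR_sum_right mult.commute sum_negf)
  finally have "2 *\<^sub>R (\<Sum>a\<in>UNIV. \<Sum>b\<in>UNIV. ?t a b) = 2 *\<^sub>R (- (v \<bullet> v) *\<^sub>R x)"
    by (simp add: scaleR_2)
  then show ?thesis unfolding S by (rule scaleR_left_imp_eq[rotated]) simp
qed

text \<open>A unit vector acts by a skew map with square -1, hence isometrically; elements of the
  spin group are products of such maps.\<close>

lemma spin_group_cip:
  assumes \<gamma>: "spinor_module \<gamma>" and A: "A \<in> spin_group \<gamma>"
  shows "cip (A *v x) (A *v y) = cip x y"
proof -
  obtain vs where vs: "\<forall>v\<in>set vs. norm v = 1" and A: "A = foldr (\<lambda>v A. clif_vec \<gamma> v ** A) vs (mat 1)"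
    using A by (auto simp: spin_group_def)
  have "cip (foldr (\<lambda>v A. clif_vec \<gamma> v ** A) vs (mat 1) *v x) (foldr (\<lambda>v A. clif_vec \<gamma> v ** A) vs (mat 1) *v y)
      = cip x y"
    using vs
  proof (induction vs)
    case (Cons v vs)
    then have "v \<bullet> v = 1" by (simp add: norm_eq_1)
    with Cons show ?case
      by (simp add: cip_clif_vec[OF \<gamma>] clif_vec_square[OF \<gamma>] cip_simps flip: matrix_vector_mul_assoc)
  qed simp
  then show ?thesis by (simp add: A)
qed

section \<open>Independence of the fibre metric of the chosen indices\<close>

lemma gip_expand: "gip N j q u v = (\<Sum>b\<in>UNIV. \<Sum>c\<in>UNIV. gmat N j q $ b $ c * u $ b * v $ c)"
  by (simp add: gip_def inner_vec_def matrix_vector_mult_def sum_distrib_left mult_ac)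

lemma gmat_jac:
  assumes "riemannian_manifold H N" "q \<in> patch N j \<inter> patch N j'"
  shows "gmat N j q $ d $ e =
    (\<Sum>b\<in>UNIV. \<Sum>c\<in>UNIV. gmat N j' q $ b $ c * jac H N j' j q $ b $ d * jac H N j' j q $ c $ e)"
proof -
  have "gmat N j q $ d $ e = gip N j q (axis d 1) (axis e 1)"
    by (simp add: gip_def inner_axis' matrix_vector_mult_basis column_def)
  also have "\<dots> = gip N j' q (column d (jac H N j' j q)) (column e (jac H N j' j q))"
    using gip_jac[OF assms] by (simp add: matrix_vector_mult_basis)
  finally show ?thesis by (simp add: gip_expand column_def)
qed

text \<open>The lifts preserve \<open>cip\<close> on the spinor factor, and the Jacobians on the
  other factor are absorbed by the transformation law of the metric of \<open>N\<close>.\<close>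

lemma tw_ip_change:
  assumes N: "riemannian_manifold UNIV N" and S: "spin_structure k M"
    and u: "u \<in> rough_sections k M N f W" and v: "v \<in> rough_sections k M N f W"
    and p: "p \<in> W \<inter> patch M i \<inter> patch M i' \<inter> f -` (patch N j \<inter> patch N j')"
  shows "tw_ip N j' (f p) (u i' j' p) (v i' j' p) = tw_ip N j (f p) (u i j p) (v i j p)"
proof -
  let ?J = "jac UNIV N j' j (f p)" and ?g' = "gmat N j' (f p)"
  have "spinor_module (clif M)" using S by (simp add: spin_structure_def)
  moreover have "lift M i' i p \<in> spin_group (clif M)"
    using S p unfolding spin_structure_def by blast
  ultimately have L: "cip (lift M i' i p *v x) (lift M i' i p *v y) = cip x y" for x y
    by (rule spin_group_cip)
  have g: "gmat N j (f p) $ d $ e = (\<Sum>b\<in>UNIV. \<Sum>c\<in>UNIV. ?g' $ b $ c * ?J $ b $ d * ?J $ c $ e)" for d e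
    using p by (intro gmat_jac[OF N]) auto
  let ?t = "\<lambda>b c d e. (?g' $ b $ c * ?J $ b $ d * ?J $ c $ e) *\<^sub>R cip (u i j p $ d) (v i j p $ e)"
  have "tw_ip N j' (f p) (u i' j' p) (v i' j' p) = (\<Sum>b\<in>UNIV. \<Sum>c\<in>UNIV. \<Sum>e\<in>UNIV. \<Sum>d\<in>UNIV. ?t b c d e)"
    unfolding tw_ip_def rough_section_transform[OF u p] rough_section_transform[OF v p]
    by (simp add: cip_simps L scaleR_sum_right mult_ac)
  \<comment> \<open>The sums over \<open>b\<close> and \<open>c\<close>, which belong to chart
    \<open>j'\<close>, are moved inside step by step; there they add up to the metric in chart
    \<open>j\<close>.\<close>
  also have "\<dots> = (\<Sum>b\<in>UNIV. \<Sum>e\<in>UNIV. \<Sum>c\<in>UNIV. \<Sum>d\<in>UNIV. ?t b c d e)"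
    by (rule sum.cong[OF refl], rule sum.swap)
  also have "\<dots> = (\<Sum>b\<in>UNIV. \<Sum>e\<in>UNIV. \<Sum>d\<in>UNIV. \<Sum>c\<in>UNIV. ?t b c d e)"
    by (rule sum.cong[OF refl], rule sum.cong[OF refl], rule sum.swap)
  also have "\<dots> = (\<Sum>e\<in>UNIV. \<Sum>b\<in>UNIV. \<Sum>d\<in>UNIV. \<Sum>c\<in>UNIV. ?t b c d e)"
    by (rule sum.swap)
  also have "\<dots> = (\<Sum>e\<in>UNIV. \<Sum>d\<in>UNIV. \<Sum>b\<in>UNIV. \<Sum>c\<in>UNIV. ?t b c d e)"
    by (rule sum.cong[OF refl], rule sum.swap)
  also have "\<dots> = (\<Sum>d\<in>UNIV. \<Sum>e\<in>UNIV. \<Sum>b\<in>UNIV. \<Sum>c\<in>UNIV. ?t b c d e)"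
    by (rule sum.swap)
  also have "\<dots> = tw_ip N j (f p) (u i j p) (v i j p)"
    unfolding tw_ip_def g by (simp add: scaleR_sum_left)
  finally show ?thesis .
qed

text \<open>The indices picked by \<open>SOME\<close> in \<open>pt_ip\<close> may jump from point to
  point. Continuity is proved with a fixed pair of indices instead.\<close>

lemma pt_ip_eq:
  assumes N: "riemannian_manifold UNIV N" and S: "spin_structure k M"
    and u: "u \<in> rough_sections k M N f W" and v: "v \<in> rough_sections k M N f W"
    and p: "p \<in> W" "p \<in> patch M i" "f p \<in> patch N j"
  shows "pt_ip M N f u v p = tw_ip N j (f p) (u i j p) (v i j p)"
proof -
  have "p \<in> patch M (SOME i. p \<in> patch M i)" using p(2) by (rule someI)
  moreover have "f p \<in> patch N (SOME j. f p \<in> patch N j)" using p(3) by (rule someI)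
  ultimately show ?thesis
    unfolding pt_ip_def Let_def using p by (intro tw_ip_change[OF N S u v]) auto
qed

section \<open>Continuity and integrability of smooth sections over the boundary\<close>

lemma smooth_section_continuous:
  assumes "riemannian_manifold H M" "u \<in> smooth_sections k M N f W"
  shows "continuous_on (W \<inter> f -` patch N j \<inter> patch M i) (u i j)"
  using assms by (intro continuous_on_chart) (auto simp: smooth_sections_def)

lemma continuous_on_pt_ip:
  assumes M: "riemannian_manifold (half_space k) M" and N: "riemannian_manifold UNIV N"
    and S: "spin_structure k M" and f: "continuous_on UNIV f"
    and u: "u \<in> smooth_sections k M N f W" and v: "v \<in> smooth_sections k M N f W"
  shows "continuous_on W (pt_ip M N f u v)"
  unfolding continuous_on_eq_continuous_within
proof
  fix p assume p: "p \<in> W"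
  obtain i j where ij: "p \<in> patch M i" "f p \<in> patch N j"
    using patch_cover[OF M] patch_cover[OF N] by metis
  let ?U = "f -` patch N j \<inter> patch M i"
  have "open ?U" using open_vimage[OF open_patch[OF N] f] open_patch[OF M] by auto
  have cont: "continuous_on (W \<inter> ?U) (u i j)" "continuous_on (W \<inter> ?U) (v i j)"
    using smooth_section_continuous[OF M u] smooth_section_continuous[OF M v] by (simp_all add: Int_assoc)
  have "continuous_on (patch N j) (gmat N j)"
    using continuous_on_chart[OF N smooth_gmat[OF N]] by simp
  then have g: "continuous_on (W \<inter> ?U) (\<lambda>p. gmat N j (f p))"
    by (rule continuous_on_compose2) (auto intro: continuous_on_subset[OF f])
  have "continuous_on (W \<inter> ?U) (\<lambda>p. tw_ip N j (f p) (u i j p) (v i j p))"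
    unfolding tw_ip_def
    by (intro continuous_intros bounded_bilinear.continuous_on[OF bounded_bilinear_cip] g cont)
  then have "continuous_on (W \<inter> ?U) (pt_ip M N f u v)"
    by (rule continuous_on_eq)
      (auto intro!: pt_ip_eq[OF N S smooth_section_rough[OF u] smooth_section_rough[OF v], symmetric])
  then have "continuous (at p within (W \<inter> ?U)) (pt_ip M N f u v)"
    using p ij by (simp add: continuous_on_eq_continuous_within)
  moreover have "at p within (W \<inter> ?U) = at p within W"
    using \<open>open ?U\<close> ij by (intro at_within_nhd[of p ?U]) auto
  ultimately show "continuous (at p within W) (pt_ip M N f u v)" by simp
qed

text \<open>The product is bounded on the compact boundary, vanishes off it, and the measure is
  finite.\<close>

lemma integrable_pt_ip:
  fixes M :: "('p::{t2_space,second_countable_topology}, 'i, 'n::finite, 's::finite, 'z) spin_scheme"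
  assumes M: "riemannian_manifold (half_space k) M" and N: "riemannian_manifold UNIV N"
    and S: "spin_structure k M" and f: "continuous_on UNIV f"
    and compact: "compact (UNIV :: 'p set)" and \<mu>: "bdry_measure k M \<mu>"
    and u: "u \<in> smooth_sections k M N f (bdry k M)" and v: "v \<in> smooth_sections k M N f (bdry k M)"
  shows "integrable \<mu> (pt_ip M N f u v)"
proof -
  interpret finite_measure \<mu> by (rule finite_bdry_measure[OF M compact \<mu>])
  have cont: "continuous_on (bdry k M) (pt_ip M N f u v)"
    by (rule continuous_on_pt_ip[OF M N S f u v])
  have "compact (bdry k M)"
    using compact_Int_closed[OF compact closed_bdry[OF M]] by simp
  then have "bounded (pt_ip M N f u v ` bdry k M)"
    by (intro compact_imp_bounded compact_continuous_image cont)
  then obtain C where C: "\<And>p. p \<in> bdry k M \<Longrightarrow> norm (pt_ip M N f u v p) \<le> C"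
    unfolding bounded_iff by blast
  have off: "pt_ip M N f u v p = 0" if "p \<notin> bdry k M" for p
    using that rough_section_eq_0[OF smooth_section_rough[OF u]]
    by (simp add: pt_ip_def tw_ip_def cip_def Let_def)
  have "(\<lambda>p. indicator (bdry k M) p *\<^sub>R pt_ip M N f u v p) \<in> borel_measurable borel"
    using closed_bdry[OF M] by (intro borel_measurable_continuous_on_indicator cont) auto
  moreover have "(\<lambda>p. indicator (bdry k M) p *\<^sub>R pt_ip M N f u v p) = pt_ip M N f u v"
    using off by (auto simp: indicator_def)
  ultimately have "pt_ip M N f u v \<in> borel_measurable \<mu>"
    using \<mu> by (simp add: bdry_measure_def cong: measurable_cong_sets)
  \<comment> \<open>The maximum with 0 takes care of the points off the boundary, where the product
    is zero.\<close>
  moreover have "norm (pt_ip M N f u v p) \<le> max C 0" for p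
    using C off by (cases "p \<in> bdry k M") (auto intro: le_max_iff_disj[THEN iffD2])
  ultimately show ?thesis by (intro integrable_const_bound[of _ "max C 0"]) auto
qed

text \<open>Makes \<open>preserves_condition\<close>, which quantifies over square-integrable
  sections, applicable to smooth ones. Each representative is continuous on a Borel set and zero
  outside it, hence measurable.\<close>

lemma smooth_section_L2:
  fixes M :: "('p::{t2_space,second_countable_topology}, 'i, 'n::finite, 's::finite, 'z) spin_scheme"
  assumes M: "riemannian_manifold (half_space k) M" and N: "riemannian_manifold UNIV N"
    and S: "spin_structure k M" and f: "continuous_on UNIV f"
    and compact: "compact (UNIV :: 'p set)" and \<mu>: "bdry_measure k M \<mu>"
    and u: "u \<in> smooth_sections k M N f (bdry k M)"
  shows "u \<in> L2_sections k M N \<mu> f"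
proof -
  have "u i j \<in> borel_measurable borel" for i j
  proof -
    let ?A = "bdry k M \<inter> f -` patch N j \<inter> patch M i"
    have "?A \<in> sets borel"
      using closed_bdry[OF M] open_vimage[OF open_patch[OF N] f] open_patch[OF M] by auto
    then have "(\<lambda>p. indicator ?A p *\<^sub>R u i j p) \<in> borel_measurable borel"
      by (intro borel_measurable_continuous_on_indicator smooth_section_continuous[OF M u])
    moreover have "(\<lambda>p. indicator ?A p *\<^sub>R u i j p) = u i j"
      using rough_section_eq_0[OF smooth_section_rough[OF u]] by (auto simp: indicator_def fun_eq_iff)
    ultimately show ?thesis by simp
  qed
  then show ?thesis
    using smooth_section_rough[OF u] integrable_pt_ip[OF assms u] by (simp add: L2_sections_def)
qed

section \<open>Boundary traces as distributions\<close>

lemma bdry_restrict_smooth_section: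
  assumes M: "riemannian_manifold H M" and \<phi>: "\<phi> \<in> smooth_sections k M N f UNIV"
  shows "bdry_restrict k M \<phi> \<in> smooth_sections k M N f (bdry k M)"
proof -
  note rough = smooth_section_rough[OF \<phi>]
  have "bdry_restrict k M \<phi> \<in> rough_sections k M N f (bdry k M)"
    unfolding rough_sections_def
  proof (rule CollectI, intro conjI allI ballI impI)
    fix i j p assume "p \<notin> bdry k M \<inter> patch M i \<inter> f -` patch N j"
    then show "bdry_restrict k M \<phi> i j p = 0"
      using rough_section_eq_0[OF rough] by (auto simp: bdry_restrict_def)
  next
    fix i i' j j' p b
    assume "p \<in> bdry k M \<inter> patch M i \<inter> patch M i' \<inter> f -` (patch N j \<inter> patch N j')"
    then show "bdry_restrict k M \<phi> i' j' p $ b =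
        (\<Sum>c\<in>UNIV. jac UNIV N j' j (f p) $ b $ c *\<^sub>R (lift M i' i p *v bdry_restrict k M \<phi> i j p $ c))"
      using rough_section_transform[OF rough, of p i i' j j' b] by (simp add: bdry_restrict_def)
  qed
  moreover have "smooth_in_chart M i (bdry k M \<inter> f -` patch N j) (bdry_restrict k M \<phi> i j)" for i j
    unfolding smooth_in_chart_def
  proof (rule smooth_on_cong)
    let ?A = "coord M i ` (bdry k M \<inter> f -` patch N j \<inter> patch M i)"
    show "smooth_on ?A (\<phi> i j \<circ> coord_inv M i)"
    proof (rule smooth_on_subset)
      show "smooth_on (coord M i ` (UNIV \<inter> f -` patch N j \<inter> patch M i)) (\<phi> i j \<circ> coord_inv M i)"
        using \<phi> by (simp add: smooth_sections_def smooth_in_chart_def)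
    qed auto
    show "(\<phi> i j \<circ> coord_inv M i) x = (bdry_restrict k M \<phi> i j \<circ> coord_inv M i) x" if "x \<in> ?A" for x
      using that by (auto simp: bdry_restrict_def coord_inv_coord[OF M])
  qed
  ultimately show ?thesis by (simp add: smooth_sections_def)
qed

text \<open>Linearity of the integral rests on the integrability of both products, that is, on
  compactness of the manifold.\<close>

lemma dist_of_linear_combination:
  fixes M :: "('p::{t2_space,second_countable_topology}, 'i, 'n::finite, 's::finite, 'z) spin_scheme"
  assumes M: "riemannian_manifold (half_space k) M" and N: "riemannian_manifold UNIV N"
    and S: "spin_structure k M" and f: "continuous_on UNIV f"
    and compact: "compact (UNIV :: 'p set)" and \<mu>: "bdry_measure k M \<mu>"
    and u: "u \<in> smooth_sections k M N f (bdry k M)" and v: "v \<in> smooth_sections k M N f (bdry k M)"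
  shows "dist_of k M N \<mu> f (\<lambda>i j p. r *\<^sub>R u i j p + s *\<^sub>R v i j p) =
    (\<lambda>w. r *\<^sub>R dist_of k M N \<mu> f u w + s *\<^sub>R dist_of k M N \<mu> f v w)"
proof
  fix w
  show "dist_of k M N \<mu> f (\<lambda>i j p. r *\<^sub>R u i j p + s *\<^sub>R v i j p) w =
    r *\<^sub>R dist_of k M N \<mu> f u w + s *\<^sub>R dist_of k M N \<mu> f v w"
  proof (cases "w \<in> smooth_sections k M N f (bdry k M)")
    case True
    have "pt_ip M N f (\<lambda>i j p. r *\<^sub>R u i j p + s *\<^sub>R v i j p) w p =
        r *\<^sub>R pt_ip M N f u w p + s *\<^sub>R pt_ip M N f v w p" for p
      by (simp add: pt_ip_def Let_def tw_ip_def cip_simps scaleR_add_right scaleR_sum_right sum.distrib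
          mult.commute)
    then show ?thesis
      using True integrable_pt_ip[OF M N S f compact \<mu> u True] integrable_pt_ip[OF M N S f compact \<mu> v True]
      by (simp add: dist_of_def L2_ip_def)
  qed (simp add: dist_of_def)
qed


lemma trace_chirality_parts:
  fixes M :: "('p::{t2_space,second_countable_topology}, 'i, 'n::finite, 's::finite, 'z) spin_scheme"
  assumes M: "riemannian_manifold (half_space k) M" and N: "riemannian_manifold UNIV N"
    and S: "spin_structure k M" and f: "continuous_on UNIV f"
    and compact: "compact (UNIV :: 'p set)" and \<mu>: "bdry_measure k M \<mu>"
    and G: "chirality_field k M G" and B: "boundary_condition k M N \<mu> f a B"
    and pres: "preserves_condition k M N \<mu> f G B" and tr: "trace_of k M N \<mu> f \<phi> \<in> B"
    and split: "chirality_splitting k M N f G \<phi> \<phi>p \<phi>m"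
  shows "trace_of k M N \<mu> f \<phi>p \<in> B" "trace_of k M N \<mu> f \<phi>m \<in> B"
proof -
  let ?d = "dist_of k M N \<mu> f" and ?r = "bdry_restrict k M"
  let ?w = "tw_act M G (?r \<phi>)"
  have sm: "?r \<phi>p \<in> smooth_sections k M N f (bdry k M)" "?r \<phi>m \<in> smooth_sections k M N f (bdry k M)"
    using split by (simp_all add: chirality_splitting_def bdry_restrict_smooth_section[OF M])
  have sum: "\<phi> i j p = \<phi>p i j p + \<phi>m i j p" for i j p
    using split by (simp add: chirality_splitting_def)
  have u: "?r \<phi> = (\<lambda>i j p. 1 *\<^sub>R ?r \<phi>p i j p + 1 *\<^sub>R ?r \<phi>m i j p)"
    by (auto simp: bdry_restrict_def sum fun_eq_iff)
  \<comment> \<open>The action of \<open>G\<close> is pointwise and so commutes with restriction to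
    the boundary; off the boundary it sends 0 to 0.\<close>
  have w: "?w i j p = 1 *\<^sub>R ?r \<phi>p i j p + (-1) *\<^sub>R ?r \<phi>m i j p" for i j p
  proof (cases "p \<in> bdry k M")
    case True
    then show ?thesis
      using tw_act_chirality_splitting[OF G split, of i j p]
      by (simp add: tw_act_def bdry_restrict_def split: if_splits)
  next
    case False
    then show ?thesis
      using linear_0[OF chirality_linear[OF G]] by (simp add: tw_act_def bdry_restrict_def vec_eq_iff)
  qed
  have "?r \<phi> \<in> smooth_sections k M N f (bdry k M)"
    unfolding u by (rule smooth_sections_linear_combination[OF sm])
  then have "?r \<phi> \<in> L2_sections k M N \<mu> f"
    by (rule smooth_section_L2[OF M N S f compact \<mu>])
  with pres tr have in_B: "?d (?r \<phi>) \<in> B" "?d ?w \<in> B"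
    by (auto simp: preserves_condition_def trace_of_def)
  note lin = dist_of_linear_combination[OF M N S f compact \<mu> sm]
  have du: "?d (?r \<phi>) = (\<lambda>v. ?d (?r \<phi>p) v + ?d (?r \<phi>m) v)"
    unfolding u lin by simp
  have w_eq: "?w = (\<lambda>i j p. 1 *\<^sub>R ?r \<phi>p i j p + (-1) *\<^sub>R ?r \<phi>m i j p)"
    by (intro ext w)
  have dw: "?d ?w = (\<lambda>v. ?d (?r \<phi>p) v - ?d (?r \<phi>m) v)"
    unfolding w_eq lin by simp
  note B = B[unfolded boundary_condition_def, THEN conjunct2, THEN conjunct2]
  have add: "(\<lambda>v. T v + T' v) \<in> B" if "T \<in> B" "T' \<in> B" for T T'
    using B[THEN conjunct1, rule_format, OF that] .
  have scale: "(\<lambda>v. z * T v) \<in> B" if "T \<in> B" for z T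
    using B[THEN conjunct2, THEN conjunct1, THEN spec] that by (rule bspec)
  \<comment> \<open>The factors \<open>1\<close> here and \<open>-1\<close> in the other case bring
    both combinations into the common form matched by \<open>scale\<close> and
    \<open>add\<close>.\<close>
  have p: "?d (?r \<phi>p) = (\<lambda>v. 1/2 * (?d (?r \<phi>) v + 1 * ?d ?w v))"
    unfolding du dw by auto
  show "trace_of k M N \<mu> f \<phi>p \<in> B"
    unfolding trace_of_def p by (rule scale[OF add[OF in_B(1) scale[OF in_B(2)]]])
  have m: "?d (?r \<phi>m) = (\<lambda>v. 1/2 * (?d (?r \<phi>) v + (-1) * ?d ?w v))"
    unfolding du dw by auto
  show "trace_of k M N \<mu> f \<phi>m \<in> B"
    unfolding trace_of_def m by (rule scale[OF add[OF in_B(1) scale[OF in_B(2)]]])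
qed

theorem proposition3p2:
  fixes k :: "'n::finite"
    and M :: "('p::{t2_space,second_countable_topology}, 'i, 'n, 's::finite) spin"
    and N :: "('q::{t2_space,second_countable_topology}, 'j, 'm::finite) riem"
    and \<mu> :: "'p measure"
    and bc :: "('p, 'q) map_bc"
    and f\<^sub>0 :: "'p \<Rightarrow> 'q"
    and G :: "'i \<Rightarrow> 'p \<Rightarrow> complex^'s \<Rightarrow> complex^'s"
    and a :: real
    and B :: "('p \<Rightarrow> 'q) \<Rightarrow> ('p, 'i, 'j, 's, 'm) distribution set"
    and \<phi>\<^sub>0 :: "('p, 'i, 'j, 's, 'm) twisted_spinor"
  assumes "riemannian_manifold (half_space k) M" and "compact (UNIV :: 'p set)"
    and "bdry k M \<noteq> {}" and "spin_structure k M" and "bdry_measure k M \<mu>"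
    and "riemannian_manifold UNIV N"
    and "chirality_field k M G"
    and "smooth_bc k M N bc" and "harmonic_map k M N f\<^sub>0" and "satisfies_bc k M N bc f\<^sub>0"
    and "condition_family k M N \<mu> bc a B" and "elliptic_condition k M N \<mu> f\<^sub>0 a (B f\<^sub>0)"
    and "variation_stable k M N \<mu> bc f\<^sub>0 B"
    and "preserves_condition k M N \<mu> f\<^sub>0 G (B f\<^sub>0)"
    and "\<phi>\<^sub>0 \<in> dirac_kernel k M N f\<^sub>0" and "trace_of k M N \<mu> f\<^sub>0 \<phi>\<^sub>0 \<in> B f\<^sub>0"
  shows "(\<exists>\<phi>p \<phi>m. chirality_splitting k M N f\<^sub>0 G \<phi>\<^sub>0 \<phi>p \<phi>m) \<and>
    (\<forall>\<phi>p \<phi>m. chirality_splitting k M N f\<^sub>0 G \<phi>\<^sub>0 \<phi>p \<phi>m \<longrightarrow>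
       (dirac_harmonic k M N \<mu> bc (B f\<^sub>0) f\<^sub>0 \<phi>p \<and> uncoupled k M N f\<^sub>0 \<phi>p) \<and>
       (dirac_harmonic k M N \<mu> bc (B f\<^sub>0) f\<^sub>0 \<phi>m \<and> uncoupled k M N f\<^sub>0 \<phi>m))"
proof -
  note M = assms(1) and compact = assms(2) and S = assms(4) and \<mu> = assms(5) and N = assms(6) and G = assms(7)
  have smooth_f: "smooth_map M N UNIV f\<^sub>0"
    using assms(9) by (simp add: harmonic_map_def)
  then have f: "continuous_on UNIV f\<^sub>0" by (simp add: smooth_map_def)
  have open_f: "open (f\<^sub>0 -` patch N j)" for j
    by (rule open_vimage[OF open_patch[OF N] f])
  have \<phi>\<^sub>0: "\<phi>\<^sub>0 \<in> smooth_sections k M N f\<^sub>0 UNIV"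
    using assms(15) by (simp add: dirac_kernel_def)
  have B: "boundary_condition k M N \<mu> f\<^sub>0 a (B f\<^sub>0)"
    using assms(12) by (simp add: elliptic_condition_def)
  \<comment> \<open>Both chiralities are treated together: \<open>s\<close> will be 1 for the
    positive and -1 for the negative part.\<close>
  have DH: "dirac_harmonic k M N \<mu> bc (B f\<^sub>0) f\<^sub>0 \<psi> \<and> uncoupled k M N f\<^sub>0 \<psi>"
    if ker: "\<psi> \<in> dirac_kernel k M N f\<^sub>0" and tr: "trace_of k M N \<mu> f\<^sub>0 \<psi> \<in> B f\<^sub>0" and s: "s \<noteq> 0"
      and eig: "\<And>i j p b. p \<in> patch M i \<inter> f\<^sub>0 -` patch N j \<Longrightarrow> G i p (\<psi> i j p $ b) = s *\<^sub>R \<psi> i j p $ b"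
    for \<psi> s
  proof -
    have V: "V_field k M N f\<^sub>0 \<psi> i j p = 0" if "p \<in> patch M i \<inter> f\<^sub>0 -` patch N j" for i j p
      using that eig[OF that] by (intro V_field_eq_0_if_chiral[OF N _ _ G s]) auto
    then show ?thesis
      using assms(9,10) ker tr smooth_f
      by (simp add: dirac_harmonic_def uncoupled_def harmonic_map_def)
  qed
  show ?thesis
  proof (intro conjI allI impI)
    show "\<exists>\<phi>p \<phi>m. chirality_splitting k M N f\<^sub>0 G \<phi>\<^sub>0 \<phi>p \<phi>m"
      by (rule chirality_splitting_exists[OF M G \<phi>\<^sub>0])
  next
    fix \<phi>p \<phi>m assume split: "chirality_splitting k M N f\<^sub>0 G \<phi>\<^sub>0 \<phi>p \<phi>m"
    note ker = dirac_kernel_chirality_parts[OF M open_f G assms(15) split]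
    note tr = trace_chirality_parts[OF M N S f compact \<mu> G B assms(14,16) split]
    have p: "dirac_harmonic k M N \<mu> bc (B f\<^sub>0) f\<^sub>0 \<phi>p \<and> uncoupled k M N f\<^sub>0 \<phi>p"
      using split by (intro DH[OF ker(1) tr(1), of 1]) (simp_all add: chirality_splitting_def)
    have m: "dirac_harmonic k M N \<mu> bc (B f\<^sub>0) f\<^sub>0 \<phi>m \<and> uncoupled k M N f\<^sub>0 \<phi>m"
      using split by (intro DH[OF ker(2) tr(2), of "-1"]) (simp_all add: chirality_splitting_def)
    from p m show "dirac_harmonic k M N \<mu> bc (B f\<^sub>0) f\<^sub>0 \<phi>p" "uncoupled k M N f\<^sub>0 \<phi>p"
      "dirac_harmonic k M N \<mu> bc (B f\<^sub>0) f\<^sub>0 \<phi>m" "uncoupled k M N f\<^sub>0 \<phi>m"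
      by simp_all
  qed
qed

end
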